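(* Let $G$ be a group with a ramification data $\mathfrak{r}=\sum_{C\in\mathcal{C}}\mathfrak{r}_C C$ and let $K$ be an arbitrary field. Then $$\mathrm{GKdim}(L_K(\Gamma_{G,\mathfrak{r}}))=\begin{cases}\infty & \text{if } \sum_{C\in\mathcal{C}}\mathfrak{r}_C|C|\ge 2 \text{ and } S_{G,\mathfrak{r}} \text{ is a submonoid of } G;\\ 1 & \text{if } \sum_{C\in\mathcal{C}}\mathfrak{r}_C|C|=1 \text{ and } S_{G,\mathfrak{r}} \text{ is a submonoid of } G;\\ 0 & \text{otherwise.}\end{cases}$$
   Context: Leavitt path algebra. A (directed) graph $E=(E^0,E^1,r,s)$ consists of disjoint sets $E^0$ (vertices) and $E^1$ (edges) and maps $r,s:E^1\to E^0$ (range, source). For a field $K$, $L_K(E)$ is the (not necessarily unital) associative $K$-algebra generated by $E^0\cup E^1\cup\{e^*: e\in E^1\}$ subject to, for all $v,w\in E^0$ and $e,f\in E^1$: (i) $vw=\delta_{v,w}w$; (ii) $s(e)e=e=e\,r(e)$ and $r(e)e^*=e^*=e^*s(e)$; (iii) $e^*f=\delta_{e,f}r(e)$; (iv) $v=\sum_{e\in s^{-1}(v)}ee^*$ for every vertex $v$ with $0<|s^{-1}(v)|<\infty$. Hopf graphs. Let $G$ be a group and $\mathcal{C}$ its set of conjugacy classes. A ramification data of $G$ is a function $\mathfrak{r}:\mathcal{C}\to\mathbb{N}=\{0,1,2,\dots\}$, written $\mathfrak{r}=\sum_{C\in\mathcal{C}}\mathfrak{r}_C C$ with $\mathfrak{r}_C=\mathfrak{r}(C)$;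 $\mathrm{supp}(\mathfrak{r})=\{C:\mathfrak{r}_C>0\}$. The Hopf graph $\Gamma_{G,\mathfrak{r}}$ has vertex set $G$ and, for each $x\in G$, $C\in\mathcal{C}$ and $c\in C$, exactly $\mathfrak{r}_C$ edges from $x$ to $xc$. $S_{G,\mathfrak{r}}$ is the subsemigroup of $G$ generated by $\bigcup_{C\in\mathrm{supp}(\mathfrak{r})}C$ (empty if $\mathfrak{r}=0$); it is a submonoid of $G$ if it contains $1_G$. The sum $\sum_{C}\mathfrak{r}_C|C|$ is a cardinal, possibly infinite. Gelfand-Kirillov dimension. For a finitely generated $K$-algebra $A$, $\mathrm{GKdim}(A)=\limsup_{n\to\infty}\log_n(\dim V^n)$, where $V$ is any finite dimensional subspace generating $A$ as a $K$-algebra (with the usual convention that $V^n$ is the span of products of at most $n$ elements of $V$). For general $A$, $\mathrm{GKdim}(A)$ is the supremum of $\mathrm{GKdim}(B)$ over the finitely generated subalgebras $B$ of $A$. *)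

theory Defs
  imports
    "HOL-Algebra.QuotRing"
    "HOL-Algebra.Module"
    "HOL-Library.Poly_Mapping"
    "HOL-Library.Extended_Real"
    "Graph_Theory.Digraph"
begin

unbundle cardinal_syntax

section \<open>Algebras over a field\<close>

text \<open>
  A not necessarily unital algebra over a field is given by a \<^type>\<open>module\<close> record whose scalars
  form a type of class \<^class>\<open>field\<close>. The field \<open>one\<close> of the record carries no meaning: it is not
  required to be a unit or even to lie in the carrier, and no definition about algebras in
  general depends on it.
\<close>

definition is_subspace :: "('k::field, 'a) module \<Rightarrow> 'a set \<Rightarrow> bool" where
  "is_subspace A W \<longleftrightarrow> W \<subseteq> carrier A \<and> \<zero>\<^bsub>A\<^esub> \<in> W \<and>
     (\<forall>x\<in>W. \<forall>y\<in>W. x \<oplus>\<^bsub>A\<^esub> y \<in> W) \<and> (\<forall>c. \<forall>x\<in>W. c \<odot>\<^bsub>A\<^esub> x \<in> W)"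

definition is_subalgebra :: "('k::field, 'a) module \<Rightarrow> 'a set \<Rightarrow> bool" where
  "is_subalgebra A B \<longleftrightarrow> is_subspace A B \<and> (\<forall>x\<in>B. \<forall>y\<in>B. x \<otimes>\<^bsub>A\<^esub> y \<in> B)"

inductive_set lin_span :: "('k::field, 'a) module \<Rightarrow> 'a set \<Rightarrow> 'a set"
  for A and S where
  incl: "x \<in> S \<Longrightarrow> x \<in> lin_span A S"
| zero: "\<zero>\<^bsub>A\<^esub> \<in> lin_span A S"
| add: "x \<in> lin_span A S \<Longrightarrow> y \<in> lin_span A S \<Longrightarrow> x \<oplus>\<^bsub>A\<^esub> y \<in> lin_span A S"
| smult: "x \<in> lin_span A S \<Longrightarrow> c \<odot>\<^bsub>A\<^esub> x \<in> lin_span A S"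

inductive_set generated_subalgebra :: "('k::field, 'a) module \<Rightarrow> 'a set \<Rightarrow> 'a set"
  for A and S where
  incl: "x \<in> S \<Longrightarrow> x \<in> generated_subalgebra A S"
| zero: "\<zero>\<^bsub>A\<^esub> \<in> generated_subalgebra A S"
| add: "x \<in> generated_subalgebra A S \<Longrightarrow> y \<in> generated_subalgebra A S \<Longrightarrow>
    x \<oplus>\<^bsub>A\<^esub> y \<in> generated_subalgebra A S"
| smult: "x \<in> generated_subalgebra A S \<Longrightarrow> c \<odot>\<^bsub>A\<^esub> x \<in> generated_subalgebra A S"
| mult: "x \<in> generated_subalgebra A S \<Longrightarrow> y \<in> generated_subalgebra A S \<Longrightarrow>
    x \<otimes>\<^bsub>A\<^esub> y \<in> generated_subalgebra A S"

definition finitely_generated :: "('k::field, 'a) module \<Rightarrow> bool" where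
  "finitely_generated A \<longleftrightarrow>
     (\<exists>S. finite S \<and> S \<subseteq> carrier A \<and> generated_subalgebra A S = carrier A)"

definition lin_independent :: "('k::field, 'a) module \<Rightarrow> 'a set \<Rightarrow> bool" where
  "lin_independent A B \<longleftrightarrow>
     (\<forall>c :: 'a \<Rightarrow> 'k. (\<Oplus>\<^bsub>A\<^esub>x\<in>B. c x \<odot>\<^bsub>A\<^esub> x) = \<zero>\<^bsub>A\<^esub> \<longrightarrow> (\<forall>x\<in>B. c x = 0))"

definition finite_basis :: "('k::field, 'a) module \<Rightarrow> 'a set \<Rightarrow> 'a set \<Rightarrow> bool" where
  "finite_basis A V B \<longleftrightarrow> finite B \<and> B \<subseteq> V \<and> lin_independent A B \<and> lin_span A B = V"

definition finite_dimensional :: "('k::field, 'a) module \<Rightarrow> 'a set \<Rightarrow> bool" where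
  "finite_dimensional A V \<longleftrightarrow> (\<exists>B. finite_basis A V B)"

text \<open>Only meaningful for finite-dimensional \<open>V\<close>.\<close>
definition lin_dim :: "('k::field, 'a) module \<Rightarrow> 'a set \<Rightarrow> nat" where
  "lin_dim A V = card (SOME B. finite_basis A V B)"


section \<open>Gelfand-Kirillov dimension\<close>

definition subspace_power :: "('k::field, 'a) module \<Rightarrow> 'a set \<Rightarrow> nat \<Rightarrow> 'a set" where
  "subspace_power A V n =
     lin_span A {foldl (\<otimes>\<^bsub>A\<^esub>) x xs | x xs. x \<in> V \<and> set xs \<subseteq> V \<and> length xs < n}"

definition generating_subspace :: "('k::field, 'a) module \<Rightarrow> 'a set \<Rightarrow> bool" where
  "generating_subspace A V \<longleftrightarrow>
     is_subspace A V \<and> finite_dimensional A V \<and> generated_subalgebra A V = carrier A"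

text \<open>
  The value does not depend on the choice of the generating subspace. For the zero algebra, all
  the dimensions are \<open>0\<close> and the value is \<open>0\<close>, because of the convention \<open>ln 0 = 0\<close>; this does not
  affect the supremum defining \<open>GKdim A\<close> for a nonzero algebra \<open>A\<close>.
\<close>
definition GKdim_fg :: "('k::field, 'a) module \<Rightarrow> ereal" where
  "GKdim_fg A =
     (let V = (SOME V. generating_subspace A V)
      in limsup (\<lambda>n. ereal (log (real n) (real (lin_dim A (subspace_power A V n))))))"

definition GKdim :: "('k::field, 'a) module \<Rightarrow> ereal" where
  "GKdim A =
     (SUP B \<in> {B. is_subalgebra A B \<and> finitely_generated (A\<lparr>carrier := B\<rparr>)}.
        GKdim_fg (A\<lparr>carrier := B\<rparr>))"


section \<open>Algebras given by generators and relations\<close>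

text \<open>The free monoid, written additively so that \<^type>\<open>poly_mapping\<close> provides its monoid ring.\<close>
datatype 'x free_monoid = Word (letters: "'x list")

instantiation free_monoid :: (type) monoid_add
begin

definition zero_free_monoid :: "'a free_monoid" where
  "zero_free_monoid = Word []"

definition plus_free_monoid :: "'a free_monoid \<Rightarrow> 'a free_monoid \<Rightarrow> 'a free_monoid" where
  "plus_free_monoid u v = Word (letters u @ letters v)"

instance
  by standard (simp_all add: zero_free_monoid_def plus_free_monoid_def)

end

text \<open>Excluding the empty word makes this the free non-unital algebra.\<close>
definition free_algebra :: "'x set \<Rightarrow> ('k::field, 'x free_monoid \<Rightarrow>\<^sub>0 'k) module" where
  "free_algebra X =
     \<lparr>carrier = {f. \<forall>w \<in> Poly_Mapping.keys f. letters w \<noteq> [] \<and> set (letters w) \<subseteq> X},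
      monoid.mult = (*), one = 1, zero = 0, add = (+),
      smult = (\<lambda>c. Poly_Mapping.map ((*) c))\<rparr>"

definition free_gen :: "'x \<Rightarrow> ('x free_monoid \<Rightarrow>\<^sub>0 'k::field)" where
  "free_gen x = Poly_Mapping.single (Word [x]) 1"

inductive_set generated_ideal :: "('k::field, 'a) module \<Rightarrow> 'a set \<Rightarrow> 'a set"
  for A and R where
  incl: "x \<in> R \<Longrightarrow> x \<in> generated_ideal A R"
| zero: "\<zero>\<^bsub>A\<^esub> \<in> generated_ideal A R"
| add: "x \<in> generated_ideal A R \<Longrightarrow> y \<in> generated_ideal A R \<Longrightarrow>
    x \<oplus>\<^bsub>A\<^esub> y \<in> generated_ideal A R"
| smult: "x \<in> generated_ideal A R \<Longrightarrow> c \<odot>\<^bsub>A\<^esub> x \<in> generated_ideal A R"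
| mult_left: "a \<in> carrier A \<Longrightarrow> x \<in> generated_ideal A R \<Longrightarrow>
    a \<otimes>\<^bsub>A\<^esub> x \<in> generated_ideal A R"
| mult_right: "a \<in> carrier A \<Longrightarrow> x \<in> generated_ideal A R \<Longrightarrow>
    x \<otimes>\<^bsub>A\<^esub> a \<in> generated_ideal A R"

definition quotient_algebra :: "('k::field, 'a) module \<Rightarrow> 'a set \<Rightarrow> ('k, 'a set) module" where
  "quotient_algebra A I =
     \<lparr>carrier = a_rcosets\<^bsub>A\<^esub> I, monoid.mult = rcoset_mult A I, one = I +>\<^bsub>A\<^esub> \<one>\<^bsub>A\<^esub>,
      zero = I, add = set_add A,
      smult = (\<lambda>c P. \<Union>x\<in>P. I +>\<^bsub>A\<^esub> (c \<odot>\<^bsub>A\<^esub> x))\<rparr>"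

definition presented_algebra ::
  "'x set \<Rightarrow> ('x free_monoid \<Rightarrow>\<^sub>0 'k) set \<Rightarrow> ('k::field, ('x free_monoid \<Rightarrow>\<^sub>0 'k) set) module" where
  "presented_algebra X R = quotient_algebra (free_algebra X) (generated_ideal (free_algebra X) R)"


section \<open>Leavitt path algebras\<close>

text \<open>The source of an arc is its \<^const>\<open>tail\<close>, its range is its \<^const>\<open>head\<close>.\<close>

datatype ('v, 'e) leavitt_gen = Vertex 'v | Edge 'e | Ghost 'e

definition leavitt_gens :: "('v, 'e) pre_digraph \<Rightarrow> ('v, 'e) leavitt_gen set" where
  "leavitt_gens E = Vertex ` verts E \<union> Edge ` arcs E \<union> Ghost ` arcs E"

definition leavitt_relations ::
  "('v, 'e) pre_digraph \<Rightarrow> (('v, 'e) leavitt_gen free_monoid \<Rightarrow>\<^sub>0 'k::field) set" where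
  "leavitt_relations E =
    (let vx = (\<lambda>v. free_gen (Vertex v));
         ed = (\<lambda>e. free_gen (Edge e));
         gh = (\<lambda>e. free_gen (Ghost e))
     in {vx v * vx w - (if v = w then vx w else 0) | v w. v \<in> verts E \<and> w \<in> verts E}
      \<union> {vx (tail E e) * ed e - ed e | e. e \<in> arcs E}
      \<union> {ed e * vx (head E e) - ed e | e. e \<in> arcs E}
      \<union> {vx (head E e) * gh e - gh e | e. e \<in> arcs E}
      \<union> {gh e * vx (tail E e) - gh e | e. e \<in> arcs E}
      \<union> {gh e * ed f - (if e = f then vx (head E e) else 0) | e f. e \<in> arcs E \<and> f \<in> arcs E}
      \<union> {vx v - (\<Sum>e\<in>out_arcs E v. ed e * gh e) | v.
           v \<in> verts E \<and> finite (out_arcs E v) \<and> out_arcs E v \<noteq> {}})"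

definition leavitt_path_algebra ::
  "'k::field itself \<Rightarrow> ('v, 'e) pre_digraph \<Rightarrow>
     ('k, (('v, 'e) leavitt_gen free_monoid \<Rightarrow>\<^sub>0 'k) set) module" where
  "leavitt_path_algebra K E = presented_algebra (leavitt_gens E) (leavitt_relations E)"


section \<open>Hopf graphs\<close>

definition conj_classes :: "('g, 'm) monoid_scheme \<Rightarrow> 'g set set" where
  "conj_classes G =
     (\<lambda>x. {g \<otimes>\<^bsub>G\<^esub> x \<otimes>\<^bsub>G\<^esub> inv\<^bsub>G\<^esub> g | g. g \<in> carrier G}) ` carrier G"

text \<open>
  A ramification data is a function \<open>r :: 'g set \<Rightarrow> nat\<close>, of which only the values on
  \<^term>\<open>conj_classes G\<close> are used. The arc \<open>(x, c, i)\<close> is the \<open>i\<close>-th arc from \<open>x\<close> to \<open>x c\<close>; the class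
  \<open>C\<close> of \<open>c\<close> is unique.
\<close>
definition hopf_graph ::
  "('g, 'm) monoid_scheme \<Rightarrow> ('g set \<Rightarrow> nat) \<Rightarrow> ('g, 'g \<times> 'g \<times> nat) pre_digraph" where
  "hopf_graph G r =
     \<lparr>verts = carrier G,
      arcs = {(x, c, i). x \<in> carrier G \<and> (\<exists>C\<in>conj_classes G. c \<in> C \<and> i < r C)},
      tail = (\<lambda>(x, c, i). x),
      head = (\<lambda>(x, c, i). x \<otimes>\<^bsub>G\<^esub> c)\<rparr>"

definition ramification_support :: "('g, 'm) monoid_scheme \<Rightarrow> ('g set \<Rightarrow> nat) \<Rightarrow> 'g set set" where
  "ramification_support G r = {C \<in> conj_classes G. r C > 0}"

inductive_set generated_subsemigroup :: "('g, 'm) monoid_scheme \<Rightarrow> 'g set \<Rightarrow> 'g set"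
  for G and S where
  incl: "x \<in> S \<Longrightarrow> x \<in> generated_subsemigroup G S"
| mult: "x \<in> generated_subsemigroup G S \<Longrightarrow> y \<in> generated_subsemigroup G S \<Longrightarrow>
    x \<otimes>\<^bsub>G\<^esub> y \<in> generated_subsemigroup G S"

definition ramification_semigroup :: "('g, 'm) monoid_scheme \<Rightarrow> ('g set \<Rightarrow> nat) \<Rightarrow> 'g set" where
  "ramification_semigroup G r = generated_subsemigroup G (\<Union> (ramification_support G r))"

text \<open>The cardinal sum of the products \<open>r C * |C|\<close> over all conjugacy classes \<open>C\<close>.\<close>
definition ramification_degree ::
  "('g, 'm) monoid_scheme \<Rightarrow> ('g set \<Rightarrow> nat) \<Rightarrow> ('g set \<times> nat \<times> 'g) rel" where
  "ramification_degree G r = |SIGMA C : conj_classes G. {..<r C} \<times> C|"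

end

theory Submission
  imports Defs "HOL-Library.Function_Algebras" "HOL-Real_Asymp.Real_Asymp" "Graph_Theory.Arc_Walk"
begin

text \<open>
  Modulo the relations, every word in finitely many generators is \<open>0\<close> or a monomial \<open>\<alpha> \<beta>\<^sup>*\<close> with
  paths \<open>\<alpha>\<close>, \<open>\<beta>\<close> over the edges involved, of total length at most that of the word. If \<open>1\<close> is not
  in the semigroup, the Hopf graph has no closed path, so there are only finitely many such
  monomials and all finitely generated subalgebras are finite-dimensional. If there is only one
  label, every vertex emits and receives exactly one edge; the relation \<open>v = e e\<^sup>*\<close> then makes one of
  \<open>\<alpha>\<close>, \<open>\<beta>\<close> empty, so that the growth is at most linear.

  For the lower bounds, distinct paths starting at \<open>1\<close> are linearly independent, because they act
  independently on infinite paths graded by the integers. A label word \<open>w\<close> with product \<open>1\<close> gives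
  the powers of a closed path. Given a second label, choose a label \<open>t\<close> different from the first
  letter of \<open>w\<close>: the words \<open>w\<^sup>a t w\<^sup>b t \<dots>\<close> with \<open>m\<close> exponents below \<open>q\<close> are \<open>q\<^sup>m\<close> distinct words of
  length \<open>O(q)\<close>, whose paths from \<open>1\<close> use only finitely many edges. Hence the dimension is at least
  \<open>m\<close> for all \<open>m\<close>, even when no two cycles share a vertex.
\<close>

section \<open>Linear algebra in an algebra without unit\<close>

text \<open>The upper bounds rest on spanning sets alone, the lower bounds on independent families
  of real paths alone. The generating subspace inside \<open>GKdim_fg\<close> is an unknown choice.
  Upper bounds are therefore proved for every finite subset of the algebra, and a lower bound
  rewrites its finite set of generators in the chosen ones; this costs a constant factor in the
  length, which disappears in the limit of the logarithms. The obstacle in the infinite case is that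
  a finitely generated subalgebra sees only finitely many edges: if the group element of t has
  infinite order, words with unboundedly many letters t leave every finite set of edges. Fixing the
  number m of letters t confines the paths to the edges of m translates of one path, while the
  exponents of w stay free because w returns to the vertex where it starts. The condition on the
  first letter of w turns the blocks \<open>w^k t\<close> into a prefix code, so that the exponents
  can be read off.\<close>

locale nonunital_algebra = abelian_group A for A :: "('k::field, 'a) module" (structure) +
  assumes smult_closed [simp, intro]: "x \<in> carrier A \<Longrightarrow> c \<odot> x \<in> carrier A"
    and smult_l_distr: "x \<in> carrier A \<Longrightarrow> (c + d) \<odot> x = c \<odot> x \<oplus> d \<odot> x"
    and smult_r_distr: "x \<in> carrier A \<Longrightarrow> y \<in> carrier A \<Longrightarrow> c \<odot> (x \<oplus> y) = c \<odot> x \<oplus> c \<odot> y"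
    and smult_assoc: "x \<in> carrier A \<Longrightarrow> (c * d) \<odot> x = c \<odot> (d \<odot> x)"
    and smult_one [simp]: "x \<in> carrier A \<Longrightarrow> 1 \<odot> x = x"
    and mult_closed [simp, intro]: "x \<in> carrier A \<Longrightarrow> y \<in> carrier A \<Longrightarrow> x \<otimes> y \<in> carrier A"
    and mult_assoc: "x \<in> carrier A \<Longrightarrow> y \<in> carrier A \<Longrightarrow> z \<in> carrier A \<Longrightarrow>
      (x \<otimes> y) \<otimes> z = x \<otimes> (y \<otimes> z)"
    and mult_l_distr: "x \<in> carrier A \<Longrightarrow> y \<in> carrier A \<Longrightarrow> z \<in> carrier A \<Longrightarrow>
      (x \<oplus> y) \<otimes> z = x \<otimes> z \<oplus> y \<otimes> z"
    and mult_r_distr: "x \<in> carrier A \<Longrightarrow> y \<in> carrier A \<Longrightarrow> z \<in> carrier A \<Longrightarrow>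
      z \<otimes> (x \<oplus> y) = z \<otimes> x \<oplus> z \<otimes> y"
    and smult_mult_left: "x \<in> carrier A \<Longrightarrow> y \<in> carrier A \<Longrightarrow> (c \<odot> x) \<otimes> y = c \<odot> (x \<otimes> y)"
    and smult_mult_right: "x \<in> carrier A \<Longrightarrow> y \<in> carrier A \<Longrightarrow> x \<otimes> (c \<odot> y) = c \<odot> (x \<otimes> y)"
begin

lemma add_idem_imp_zero: "x \<in> carrier A \<Longrightarrow> x \<oplus> x = x \<Longrightarrow> x = \<zero>"
  by (metis add.l_cancel_one')

lemma smult_zero_left [simp]: "x \<in> carrier A \<Longrightarrow> 0 \<odot> x = \<zero>"
  using smult_l_distr[of x 0 0] by (intro add_idem_imp_zero) auto

lemma smult_zero_right [simp]: "c \<odot> \<zero> = \<zero>"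
  using smult_r_distr[of "\<zero>" "\<zero>" c] by (intro add_idem_imp_zero) auto

lemma mult_zero_left [simp]: "x \<in> carrier A \<Longrightarrow> \<zero> \<otimes> x = \<zero>"
  using mult_l_distr[of "\<zero>" "\<zero>" x] by (intro add_idem_imp_zero) auto

lemma mult_zero_right [simp]: "x \<in> carrier A \<Longrightarrow> x \<otimes> \<zero> = \<zero>"
  using mult_r_distr[of "\<zero>" "\<zero>" x] by (intro add_idem_imp_zero) auto

lemma add_smult_minus_one [simp]: "x \<in> carrier A \<Longrightarrow> x \<oplus> (- 1) \<odot> x = \<zero>"
  using smult_l_distr[of x 1 "- 1"] by simp

lemma lin_span_closed: "x \<in> lin_span A S \<Longrightarrow> S \<subseteq> carrier A \<Longrightarrow> x \<in> carrier A"
  by (induction rule: lin_span.induct) auto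

lemma lin_span_minimal: "x \<in> lin_span A T \<Longrightarrow> T \<subseteq> lin_span A S \<Longrightarrow> x \<in> lin_span A S"
  by (induction rule: lin_span.induct) (auto intro: lin_span.intros)

lemma lin_span_mono: "S \<subseteq> T \<Longrightarrow> lin_span A S \<subseteq> lin_span A T"
  by (meson lin_span.incl lin_span_minimal subset_iff)

text \<open>By bilinearity, products of spans are controlled by products of spanning elements.
  \<open>W\<close> is left arbitrary so that bounds on the number of factors can be carried
  along.\<close>

lemma lin_span_mult:
  assumes "\<And>s t. s \<in> S \<Longrightarrow> t \<in> T \<Longrightarrow> s \<otimes> t \<in> lin_span A W"
    and "S \<subseteq> carrier A" "T \<subseteq> carrier A"
    and "x \<in> lin_span A S" "y \<in> lin_span A T"
  shows "x \<otimes> y \<in> lin_span A W"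
proof -
  have right: "s \<otimes> y \<in> lin_span A W" if "s \<in> S" for s
    using assms(5)
  proof (induction rule: lin_span.induct)
    case (incl t)
    then show ?case using assms(1) that by blast
  next
    case zero
    have "s \<in> carrier A" using assms(2) that by blast
    then show ?case by (simp add: lin_span.zero)
  next
    case (add t u)
    then show ?case using assms(2,3) that
      by (subst mult_r_distr) (auto intro: lin_span.add dest: lin_span_closed)
  next
    case (smult t c)
    then show ?case using assms(2,3) that
      by (subst smult_mult_right) (auto intro: lin_span.smult dest: lin_span_closed)
  qed
  have yc: "y \<in> carrier A" using assms(3,5) lin_span_closed by blast
  show ?thesis using assms(4)
  proof (induction rule: lin_span.induct)
    case (incl t)
    then show ?case using right by blast
  next
    case zero
    show ?case using yc by (simp add: lin_span.zero)
  next
    case (add t u)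
    then show ?case using assms(2) yc
      by (subst mult_l_distr) (auto intro: lin_span.add dest: lin_span_closed)
  next
    case (smult t c)
    then show ?case using assms(2) yc
      by (subst smult_mult_left) (auto intro: lin_span.smult dest: lin_span_closed)
  qed
qed

section \<open>Linear combinations, exchange and the dimension of spans\<close>

definition lincomb :: "'a set \<Rightarrow> ('a \<Rightarrow> 'k) \<Rightarrow> 'a" where
  "lincomb S c = (\<Oplus>s\<in>S. c s \<odot> s)"

lemma lincomb_insert:
  "finite S \<Longrightarrow> s \<notin> S \<Longrightarrow> insert s S \<subseteq> carrier A \<Longrightarrow>
    lincomb (insert s S) c = c s \<odot> s \<oplus> lincomb S c"
  unfolding lincomb_def by (subst finsum_insert) auto

lemma lincomb_empty [simp]: "lincomb {} c = \<zero>"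
  by (simp add: lincomb_def)

lemma lincomb_cong: "S \<subseteq> carrier A \<Longrightarrow> (\<And>s. s \<in> S \<Longrightarrow> c s = d s) \<Longrightarrow> lincomb S c = lincomb S d"
  unfolding lincomb_def by (rule finsum_cong') auto

lemma lincomb_closed [simp, intro]: "S \<subseteq> carrier A \<Longrightarrow> lincomb S c \<in> carrier A"
  unfolding lincomb_def by (rule finsum_closed) auto

lemma lincomb_add:
  assumes "S \<subseteq> carrier A"
  shows "lincomb S (\<lambda>s. c s + d s) = lincomb S c \<oplus> lincomb S d"
proof -
  have "lincomb S (\<lambda>s. c s + d s) = (\<Oplus>s\<in>S. c s \<odot> s \<oplus> d s \<odot> s)"
    unfolding lincomb_def using assms by (intro finsum_cong') (auto simp: smult_l_distr subset_iff)
  also have "\<dots> = lincomb S c \<oplus> lincomb S d"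
    unfolding lincomb_def using assms by (intro finsum_addf) auto
  finally show ?thesis .
qed

lemma lincomb_smult:
  assumes "finite S" "S \<subseteq> carrier A"
  shows "lincomb S (\<lambda>s. a * c s) = a \<odot> lincomb S c"
  using assms
  by (induction S rule: finite_induct) (auto simp: lincomb_insert smult_r_distr smult_assoc)

lemma lincomb_zero: "S \<subseteq> carrier A \<Longrightarrow> lincomb S (\<lambda>s. 0) = \<zero>"
  unfolding lincomb_def by (intro add.finprod_one_eqI) auto

lemma lincomb_single:
  assumes "finite S" "S \<subseteq> carrier A" "s \<in> S"
  shows "lincomb S (\<lambda>t. if t = s then c else 0) = c \<odot> s"
proof -
  obtain T where T: "S = insert s T" "s \<notin> T" using assms(3) by (meson mk_disjoint_insert)
  then have "lincomb T (\<lambda>t. if t = s then c else 0) = lincomb T (\<lambda>t. 0)"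
    using assms by (intro lincomb_cong) auto
  then show ?thesis using T assms by (simp add: lincomb_insert lincomb_zero)
qed

lemma lincomb_in_lin_span:
  "finite S \<Longrightarrow> S \<subseteq> carrier A \<Longrightarrow> S \<subseteq> lin_span A T \<Longrightarrow> lincomb S c \<in> lin_span A T"
  by (induction S rule: finite_induct) (auto simp: lincomb_insert intro: lin_span.intros)

lemma lin_span_lincomb:
  assumes "x \<in> lin_span A S" "finite S" "S \<subseteq> carrier A"
  shows "\<exists>c. x = lincomb S c"
  using assms(1)
proof (induction rule: lin_span.induct)
  case (incl x)
  then show ?case using lincomb_single[OF assms(2,3), of x 1] assms(3) by (metis smult_one subsetD)
next
  case zero
  then show ?case using lincomb_zero[OF assms(3)] by metis
next
  case (add x y)
  then show ?case using lincomb_add[OF assms(3)] by metis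
next
  case (smult x c)
  then show ?case using lincomb_smult[OF assms(2,3)] by metis
qed

lemma lin_independent_altdef:
  "lin_independent A B \<longleftrightarrow> (\<forall>c. lincomb B c = \<zero> \<longrightarrow> (\<forall>x\<in>B. c x = 0))"
  by (simp add: lin_independent_def lincomb_def)

text \<open>A \<open>finsum\<close> over an infinite set defaults to zero, so the constant
  coefficient 1 refutes the independence of every infinite set.\<close>

lemma lin_independent_finite: "lin_independent A B \<Longrightarrow> finite B"
proof (rule ccontr)
  assume B: "lin_independent A B" "infinite B"
  then have "lincomb B (\<lambda>x. 1) = \<zero>"
    by (simp add: lincomb_def finsum_infinite)
  then have "\<forall>x\<in>B. (1::'k) = 0"
    using B(1) unfolding lin_independent_altdef by fastforce
  then show False using B(2) by force
qed

text \<open>The coordinates with respect to \<open>S\<close> reduce this to the vector space of functions into the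
  field.\<close>
lemma steinitz:
  assumes S: "finite S" "S \<subseteq> carrier A" and I: "I \<subseteq> lin_span A S" "lin_independent A I"
  shows "card I \<le> card S"
proof -
  define scale :: "'k \<Rightarrow> ('a \<Rightarrow> 'k) \<Rightarrow> 'a \<Rightarrow> 'k" where "scale = (\<lambda>c f x. c * f x)"
  interpret V: vector_space scale
    by standard (auto simp: scale_def fun_eq_iff algebra_simps)
  define u :: "'a \<Rightarrow> 'a \<Rightarrow> 'k" where "u s = (\<lambda>t. if t = s then 1 else 0)" for s
  have finI: "finite I" using I(2) by (rule lin_independent_finite)
  have Ic: "I \<subseteq> carrier A" using I(1) S(2) lin_span_closed by blast
  have "\<forall>x\<in>I. \<exists>c. x = lincomb S c \<and> (\<forall>t. t \<notin> S \<longrightarrow> c t = 0)"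
  proof
    fix x assume "x \<in> I"
    then obtain c where "x = lincomb S c" using lin_span_lincomb S I(1) by blast
    then have "x = lincomb S (\<lambda>t. if t \<in> S then c t else 0)"
      using lincomb_cong[OF S(2), of c "\<lambda>t. if t \<in> S then c t else 0"] by simp
    then show "\<exists>c. x = lincomb S c \<and> (\<forall>t. t \<notin> S \<longrightarrow> c t = 0)"
      by (intro exI[of _ "\<lambda>t. if t \<in> S then c t else 0"]) auto
  qed
  then obtain f where f: "\<And>x. x \<in> I \<Longrightarrow> x = lincomb S (f x)"
    "\<And>x t. x \<in> I \<Longrightarrow> t \<notin> S \<Longrightarrow> f x t = 0" by metis
  have inj: "inj_on f I" by (rule inj_onI) (metis f(1))
  have f_span: "f ` I \<subseteq> V.span (u ` S)"
  proof
    fix g assume "g \<in> f ` I"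
    then have g: "\<And>t. t \<notin> S \<Longrightarrow> g t = 0" using f(2) by auto
    have "g = (\<Sum>s\<in>S. scale (g s) (u s))"
    proof
      fix t
      have "(\<Sum>s\<in>S. scale (g s) (u s)) t = (\<Sum>s\<in>S. if t = s then g s else 0)"
        by (induction S rule: infinite_finite_induct) (auto simp: scale_def u_def)
      also have "\<dots> = g t" using S(1) g by auto
      finally show "g t = (\<Sum>s\<in>S. scale (g s) (u s)) t" by simp
    qed
    moreover have "(\<Sum>s\<in>S. scale (g s) (u s)) \<in> V.span (u ` S)"
      by (intro V.span_sum V.span_scale V.span_base) auto
    ultimately show "g \<in> V.span (u ` S)" by simp
  qed
  \<comment> \<open>\<open>S\<close> may be dependent, so \<open>f\<close> is a mere choice of
    coordinates. What is linear is \<open>lincomb S\<close>, and it carries relations between the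
    coordinate functions back to relations in \<open>I\<close>.\<close>
  have comb: "lincomb S (\<Sum>x\<in>J. scale (a x) (f x)) = lincomb J a" if "J \<subseteq> I" for J a
    using finite_subset[OF that finI] that
  proof (induction J rule: finite_induct)
    case empty
    then show ?case using lincomb_zero[OF S(2)] by (simp add: zero_fun_def)
  next
    case (insert x J)
    have "lincomb S (\<Sum>x\<in>insert x J. scale (a x) (f x))
        = lincomb S (\<lambda>t. a x * f x t + (\<Sum>x\<in>J. scale (a x) (f x)) t)"
      using insert by (simp add: plus_fun_def scale_def)
    also have "\<dots> = a x \<odot> x \<oplus> lincomb J a"
      using insert f(1)[of x] by (simp add: lincomb_add lincomb_smult S)
    also have "\<dots> = lincomb (insert x J) a" using insert Ic by (subst lincomb_insert) auto
    finally show ?case .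
  qed
  have "V.independent (f ` I)"
  proof (rule V.independent_if_scalars_zero)
    fix h g assume h: "(\<Sum>v\<in>f ` I. scale (h v) v) = 0" and g: "g \<in> f ` I"
    have "(\<Sum>x\<in>I. scale (h (f x)) (f x)) = 0"
      using h by (simp add: sum.reindex[OF inj])
    then have "lincomb I (h \<circ> f) = \<zero>"
      using comb[of I "h \<circ> f"] lincomb_zero[OF S(2)] by (simp add: zero_fun_def)
    then show "h g = 0" using I(2) g unfolding lin_independent_altdef by (auto simp: comp_def)
  qed (use finI in simp)
  then have "card (f ` I) \<le> card (u ` S)"
    using V.independent_span_bound[of "u ` S" "f ` I"] f_span S(1) by auto
  also have "card (u ` S) \<le> card S" using S(1) by (rule card_image_le)
  finally show ?thesis using card_image[OF inj] by simp
qed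

lemma lin_independent_insert:
  assumes B: "finite B" "B \<subseteq> carrier A" "lin_independent A B"
    and x: "x \<in> carrier A" "x \<notin> lin_span A B"
  shows "lin_independent A (insert x B)"
  unfolding lin_independent_altdef
proof (intro allI impI)
  fix c assume c: "lincomb (insert x B) c = \<zero>"
  have xB: "x \<notin> B" using x(2) lin_span.incl by metis
  have eq: "c x \<odot> x \<oplus> lincomb B c = \<zero>"
    using c B x xB by (simp add: lincomb_insert)
  have "c x = 0"
  proof (rule ccontr)
    assume cx: "c x \<noteq> 0"
    have "c x \<odot> x = c x \<odot> x \<oplus> (lincomb B c \<oplus> (- 1) \<odot> lincomb B c)"
      using B x by simp
    also have "\<dots> = (- 1) \<odot> lincomb B c"
      using B x by (subst a_assoc[symmetric]) (auto simp: eq)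
    finally have "inverse (c x) \<odot> (c x \<odot> x) = inverse (c x) \<odot> ((- 1) \<odot> lincomb B c)" by simp
    then have "x = inverse (c x) \<odot> ((- 1) \<odot> lincomb B c)"
      using x cx by (simp flip: smult_assoc)
    moreover have "lincomb B c \<in> lin_span A B"
      using B by (intro lincomb_in_lin_span) (auto intro: lin_span.incl)
    ultimately show False using x(2) by (metis lin_span.smult)
  qed
  moreover from this eq have "lincomb B c = \<zero>" using x B by simp
  ultimately show "\<forall>y\<in>insert x B. c y = 0" using B(3) unfolding lin_independent_altdef by blast
qed

text \<open>Keeps a spanning vector only if it is outside the span of those kept before. Existence
  makes the \<open>SOME\<close> in \<open>lin_dim\<close> pick a genuine basis.\<close>

lemma finite_basis_exists:
  assumes "finite S" "S \<subseteq> carrier A"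
  shows "\<exists>B \<subseteq> S. finite_basis A (lin_span A S) B"
  using assms
proof (induction S rule: finite_induct)
  case empty
  then show ?case by (auto simp: finite_basis_def lin_independent_def)
next
  case (insert x S)
  then obtain B where B: "B \<subseteq> S" "finite_basis A (lin_span A S) B" by auto
  then have span: "lin_span A B = lin_span A S" and ind: "lin_independent A B"
    and fin: "finite B" by (auto simp: finite_basis_def)
  show ?case
  proof (cases "x \<in> lin_span A B")
    case True
    have "lin_span A (insert x S) = lin_span A B"
    proof (intro equalityI subsetI)
      fix y assume "y \<in> lin_span A (insert x S)"
      moreover have "insert x S \<subseteq> lin_span A B" using True span by (auto intro: lin_span.incl)
      ultimately show "y \<in> lin_span A B" by (rule lin_span_minimal)
    next
      fix y assume "y \<in> lin_span A B"
      then show "y \<in> lin_span A (insert x S)"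
        by (rule lin_span_minimal) (use B in \<open>auto intro: lin_span.incl\<close>)
    qed
    moreover have "finite_basis A (lin_span A B) B"
      using fin ind by (auto simp: finite_basis_def intro: lin_span.incl)
    ultimately show ?thesis using B by auto
  next
    case False
    have "lin_independent A (insert x B)"
      using fin ind False B insert by (intro lin_independent_insert) auto
    moreover have "lin_span A (insert x B) = lin_span A (insert x S)"
    proof (intro equalityI subsetI)
      fix y assume "y \<in> lin_span A (insert x B)"
      then show "y \<in> lin_span A (insert x S)"
        by (rule lin_span_minimal) (use B in \<open>auto intro: lin_span.incl\<close>)
    next
      fix y assume "y \<in> lin_span A (insert x S)"
      then show "y \<in> lin_span A (insert x B)"
      proof (rule lin_span_minimal)
        have "S \<subseteq> lin_span A B" using span by (auto intro: lin_span.incl)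
        then show "insert x S \<subseteq> lin_span A (insert x B)"
          using lin_span_mono[of B "insert x B"] by (auto intro: lin_span.incl)
      qed
    qed
    ultimately have "finite_basis A (lin_span A (insert x S)) (insert x B)"
      using fin B by (auto simp: finite_basis_def intro: lin_span.incl)
    then show ?thesis using B by (metis insert_mono)
  qed
qed

lemma lin_dim_lower:
  assumes "finite S" "S \<subseteq> carrier A" "I \<subseteq> lin_span A S" "lin_independent A I"
  shows "card I \<le> lin_dim A (lin_span A S)"
proof -
  define B where "B = (SOME B. finite_basis A (lin_span A S) B)"
  have B: "finite_basis A (lin_span A S) B"
    unfolding B_def using finite_basis_exists[OF assms(1,2)] by (metis someI)
  have "card I \<le> card B"
    using B assms lin_span_closed by (intro steinitz) (auto simp: finite_basis_def)
  then show ?thesis by (simp add: lin_dim_def B_def)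
qed

lemma lin_dim_upper:
  assumes "finite S" "S \<subseteq> carrier A" "finite T" "T \<subseteq> carrier A" "S \<subseteq> lin_span A T"
  shows "lin_dim A (lin_span A S) \<le> card T"
proof -
  define B where "B = (SOME B. finite_basis A (lin_span A S) B)"
  have B: "finite_basis A (lin_span A S) B"
    unfolding B_def using finite_basis_exists[OF assms(1,2)] by (metis someI)
  then have "B \<subseteq> lin_span A T" using assms(5) lin_span_minimal by (auto simp: finite_basis_def)
  then have "card B \<le> card T"
    using B assms(3,4) by (intro steinitz) (auto simp: finite_basis_def)
  then show ?thesis by (simp add: lin_dim_def B_def)
qed

end

section \<open>Growth\<close>

text \<open>Without a unit there is no empty product, hence the separate first factor;
  \<open>length xs < n\<close> then allows between 1 and \<open>n\<close> factors. Unlike a power of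
  a subspace, this set is finite when \<open>S\<close> is.\<close>

definition power_gens :: "('k::field, 'a) module \<Rightarrow> 'a set \<Rightarrow> nat \<Rightarrow> 'a set" where
  "power_gens A S n = {foldl (\<otimes>\<^bsub>A\<^esub>) x xs | x xs. x \<in> S \<and> set xs \<subseteq> S \<and> length xs < n}"

lemma subspace_power_altdef: "subspace_power A V n = lin_span A (power_gens A V n)"
  by (simp add: subspace_power_def power_gens_def)

lemma power_gens_mono: "S \<subseteq> T \<Longrightarrow> m \<le> n \<Longrightarrow> power_gens A S m \<subseteq> power_gens A T n"
  unfolding power_gens_def by (blast intro: less_le_trans)

lemma power_gens_base: "S \<subseteq> power_gens A S (Suc n)"
  unfolding power_gens_def by (force intro: exI[of _ "[]"])

lemma finite_power_gens:
  assumes "finite S"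
  shows "finite (power_gens A S n)"
proof -
  have "power_gens A S n \<subseteq> (\<lambda>(x, xs). foldl (\<otimes>\<^bsub>A\<^esub>) x xs) ` (S \<times> {xs. set xs \<subseteq> S \<and> length xs \<le> n})"
    unfolding power_gens_def by force
  then show ?thesis
    by (rule finite_subset) (use assms finite_lists_length_le in blast)
qed

section \<open>Generated subalgebras and independence of the carrier\<close>

lemma generated_subalgebra_minimal:
  "x \<in> generated_subalgebra A S \<Longrightarrow> S \<subseteq> generated_subalgebra A T \<Longrightarrow> x \<in> generated_subalgebra A T"
  by (induction rule: generated_subalgebra.induct) (auto intro: generated_subalgebra.intros)

lemma lin_span_subset_generated_subalgebra: "lin_span A S \<subseteq> generated_subalgebra A S"
proof
  fix x assume "x \<in> lin_span A S"
  then show "x \<in> generated_subalgebra A S"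
    by (induction rule: lin_span.induct) (auto intro: generated_subalgebra.intros)
qed

lemma generated_subalgebra_lin_span:
  "generated_subalgebra A (lin_span A S) = generated_subalgebra A S"
proof (intro equalityI subsetI)
  fix x assume "x \<in> generated_subalgebra A (lin_span A S)"
  then show "x \<in> generated_subalgebra A S"
    by (rule generated_subalgebra_minimal) (rule lin_span_subset_generated_subalgebra)
next
  fix x assume "x \<in> generated_subalgebra A S"
  then show "x \<in> generated_subalgebra A (lin_span A S)"
    by (rule generated_subalgebra_minimal)
      (auto intro: generated_subalgebra.incl lin_span.incl)
qed

text \<open>The closure rules never consult the carrier, so the span of a subset of a subalgebra can
  be computed in the ambient algebra; the same holds for generated subalgebras and powers.\<close>

lemma lin_span_carrier_update [simp]: "lin_span (A\<lparr>carrier := B\<rparr>) S = lin_span A S"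
proof (intro equalityI subsetI)
  fix x assume "x \<in> lin_span (A\<lparr>carrier := B\<rparr>) S"
  then show "x \<in> lin_span A S"
    by (induction rule: lin_span.induct) (auto intro: lin_span.intros)
next
  fix x assume "x \<in> lin_span A S"
  then show "x \<in> lin_span (A\<lparr>carrier := B\<rparr>) S"
    using lin_span.zero[of "A\<lparr>carrier := B\<rparr>" S] lin_span.add[of _ "A\<lparr>carrier := B\<rparr>" S]
      lin_span.smult[of _ "A\<lparr>carrier := B\<rparr>" S]
    by (induction rule: lin_span.induct) (auto intro: lin_span.incl)
qed

lemma generated_subalgebra_carrier_update [simp]:
  "generated_subalgebra (A\<lparr>carrier := B\<rparr>) S = generated_subalgebra A S"
proof (intro equalityI subsetI)
  fix x assume "x \<in> generated_subalgebra (A\<lparr>carrier := B\<rparr>) S"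
  then show "x \<in> generated_subalgebra A S"
    by (induction rule: generated_subalgebra.induct) (auto intro: generated_subalgebra.intros)
next
  fix x assume "x \<in> generated_subalgebra A S"
  then show "x \<in> generated_subalgebra (A\<lparr>carrier := B\<rparr>) S"
    using generated_subalgebra.zero[of "A\<lparr>carrier := B\<rparr>" S]
      generated_subalgebra.add[of _ "A\<lparr>carrier := B\<rparr>" S]
      generated_subalgebra.smult[of _ "A\<lparr>carrier := B\<rparr>" S]
      generated_subalgebra.mult[of _ "A\<lparr>carrier := B\<rparr>" S]
    by (induction rule: generated_subalgebra.induct) (auto intro: generated_subalgebra.incl)
qed

lemma subspace_power_carrier_update [simp]:
  "subspace_power (A\<lparr>carrier := B\<rparr>) V n = subspace_power A V n"
  by (simp add: subspace_power_def)

context nonunital_algebra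
begin

section \<open>Products of generators and change of generators\<close>

lemma generated_subalgebra_closed:
  "x \<in> generated_subalgebra A S \<Longrightarrow> S \<subseteq> carrier A \<Longrightarrow> x \<in> carrier A"
  by (induction rule: generated_subalgebra.induct) auto

lemma is_subalgebra_generated: "S \<subseteq> carrier A \<Longrightarrow> is_subalgebra A (generated_subalgebra A S)"
  unfolding is_subalgebra_def is_subspace_def
  by (auto intro: generated_subalgebra.intros dest: generated_subalgebra_closed)

lemma foldl_mult_closed [simp]:
  "x \<in> carrier A \<Longrightarrow> set xs \<subseteq> carrier A \<Longrightarrow> foldl (\<otimes>) x xs \<in> carrier A"
  by (induction xs arbitrary: x) auto

lemma power_gens_closed: "S \<subseteq> carrier A \<Longrightarrow> power_gens A S n \<subseteq> carrier A"
  unfolding power_gens_def by (fastforce intro: foldl_mult_closed)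

lemma mult_foldl:
  "x \<in> carrier A \<Longrightarrow> y \<in> carrier A \<Longrightarrow> set ys \<subseteq> carrier A \<Longrightarrow>
    x \<otimes> foldl (\<otimes>) y ys = foldl (\<otimes>) (x \<otimes> y) ys"
  by (induction ys arbitrary: y) (auto simp: mult_assoc)

lemma power_gens_mult:
  assumes "S \<subseteq> carrier A" "x \<in> power_gens A S m" "y \<in> power_gens A S n"
  shows "x \<otimes> y \<in> power_gens A S (m + n)"
proof -
  obtain a as b bs where x: "x = foldl (\<otimes>) a as" "a \<in> S" "set as \<subseteq> S" "length as < m"
    and y: "y = foldl (\<otimes>) b bs" "b \<in> S" "set bs \<subseteq> S" "length bs < n"
    using assms(2,3) unfolding power_gens_def by blast
  have "x \<otimes> y = foldl (\<otimes>) a (as @ b # bs)"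
    using x y assms(1) by (subst y(1), subst mult_foldl) (auto intro!: foldl_mult_closed)
  moreover have "set (as @ b # bs) \<subseteq> S" "length (as @ b # bs) < m + n" using x y by auto
  ultimately show ?thesis unfolding power_gens_def using x(2) by blast
qed

lemma lin_span_power_gens_mult:
  assumes "S \<subseteq> carrier A" "x \<in> lin_span A (power_gens A S m)" "y \<in> lin_span A (power_gens A S n)"
  shows "x \<otimes> y \<in> lin_span A (power_gens A S (m + n))"
  using _ power_gens_closed[OF assms(1)] power_gens_closed[OF assms(1)] assms(2,3)
proof (rule lin_span_mult)
  fix s t assume "s \<in> power_gens A S m" "t \<in> power_gens A S n"
  then show "s \<otimes> t \<in> lin_span A (power_gens A S (m + n))"
    by (rule lin_span.incl[OF power_gens_mult[OF assms(1)]])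
qed

lemma power_gens_foldl_in_lin_span:
  assumes "S \<subseteq> carrier A" "F \<subseteq> lin_span A (power_gens A S k)"
    and "x \<in> F" "set xs \<subseteq> F"
  shows "foldl (\<otimes>) x xs \<in> lin_span A (power_gens A S (k * Suc (length xs)))"
  using assms(4)
proof (induction xs rule: rev_induct)
  case Nil
  then show ?case using assms(2,3) by auto
next
  case (snoc y ys)
  have "foldl (\<otimes>) x ys \<otimes> y \<in> lin_span A (power_gens A S (k * Suc (length ys) + k))"
    using snoc assms by (intro lin_span_power_gens_mult) auto
  then show ?case by (simp add: add.commute)
qed

text \<open>Change of generators: replacing \<open>F\<close> by \<open>S\<close> rescales the number
  of factors by the constant \<open>k\<close>. This is the reason why growth exponents do not depend
  on the generators.\<close>

lemma power_gens_in_lin_span: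
  assumes "S \<subseteq> carrier A" "F \<subseteq> lin_span A (power_gens A S k)"
  shows "power_gens A F n \<subseteq> lin_span A (power_gens A S (k * n))"
proof
  fix z assume "z \<in> power_gens A F n"
  then obtain x xs where z: "z = foldl (\<otimes>) x xs" "x \<in> F" "set xs \<subseteq> F" "length xs < n"
    unfolding power_gens_def by blast
  have "k * Suc (length xs) \<le> k * n" using z(4) by (intro mult_le_mono) auto
  then show "z \<in> lin_span A (power_gens A S (k * n))"
    using power_gens_foldl_in_lin_span[OF assms z(2,3)] z(1) lin_span_mono[OF power_gens_mono]
    by blast
qed

text \<open>By multilinearity a generating subspace can be traded for a finite spanning set. One
  inclusion is the change of generators with \<open>k = 1\<close>.\<close>

lemma subspace_power_lin_span:
  assumes "S \<subseteq> carrier A"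
  shows "subspace_power A (lin_span A S) n = lin_span A (power_gens A S n)"
proof (intro equalityI subsetI)
  fix x assume "x \<in> subspace_power A (lin_span A S) n"
  then have "x \<in> lin_span A (power_gens A (lin_span A S) n)" by (simp add: subspace_power_altdef)
  then show "x \<in> lin_span A (power_gens A S n)"
  proof (rule lin_span_minimal)
    show "power_gens A (lin_span A S) n \<subseteq> lin_span A (power_gens A S n)"
      using power_gens_in_lin_span[OF assms, of "lin_span A S" 1 n]
        lin_span_mono[OF power_gens_base[of S A 0]] by simp
  qed
next
  fix x assume "x \<in> lin_span A (power_gens A S n)"
  then show "x \<in> subspace_power A (lin_span A S) n"
    unfolding subspace_power_altdef
    using lin_span_mono[OF power_gens_mono[of S "lin_span A S" n n]] by (auto intro: lin_span.incl)
qed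

lemma generated_subalgebra_exhaustion:
  assumes "S \<subseteq> carrier A" "x \<in> generated_subalgebra A S"
  shows "\<exists>n. x \<in> lin_span A (power_gens A S n)"
  using assms(2)
proof (induction rule: generated_subalgebra.induct)
  case (incl x)
  then have "x \<in> power_gens A S 1" using power_gens_base[of S A 0] by auto
  then show ?case by (meson lin_span.incl)
next
  case zero
  show ?case by (auto intro: lin_span.zero)
next
  case (add x y)
  then obtain m n where "x \<in> lin_span A (power_gens A S m)" "y \<in> lin_span A (power_gens A S n)"
    by blast
  then have "x \<in> lin_span A (power_gens A S (max m n))" "y \<in> lin_span A (power_gens A S (max m n))"
    by (meson lin_span_mono power_gens_mono max.cobounded1 max.cobounded2 order_refl subsetD)+
  then show ?case by (auto intro: lin_span.add)
next
  case (smult x c)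
  then show ?case by (auto intro: lin_span.smult)
next
  case (mult x y)
  then obtain m n where "x \<in> lin_span A (power_gens A S m)" "y \<in> lin_span A (power_gens A S n)"
    by blast
  then have "x \<otimes> y \<in> lin_span A (power_gens A S (m + n))"
    by (rule lin_span_power_gens_mult[OF assms(1)])
  then show ?case by blast
qed

text \<open>The spans increase with \<open>n\<close>, so finitely many elements fit into a single
  one. Positivity of \<open>n\<close> keeps the rescaling factor in \<open>GKdim_lower\<close>
  nonzero.\<close>

lemma generated_subalgebra_exhaustion_finite:
  assumes "S \<subseteq> carrier A" "finite F" "F \<subseteq> generated_subalgebra A S"
  shows "\<exists>n>0. F \<subseteq> lin_span A (power_gens A S n)"
  using assms(2,3)
proof (induction F rule: finite_induct)
  case empty
  then show ?case by auto
next
  case (insert x F)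
  then obtain n where n: "n > 0" "F \<subseteq> lin_span A (power_gens A S n)" by auto
  obtain m where m: "x \<in> lin_span A (power_gens A S m)"
    using generated_subalgebra_exhaustion[OF assms(1)] insert.prems by blast
  have "lin_span A (power_gens A S m) \<subseteq> lin_span A (power_gens A S (m + n))"
    "lin_span A (power_gens A S n) \<subseteq> lin_span A (power_gens A S (m + n))"
    by (intro lin_span_mono power_gens_mono; simp)+
  then show ?case using n m by (intro exI[of _ "m + n"]) auto
qed

section \<open>Passing to a subalgebra\<close>

lemma subalgebra_is_algebra:
  assumes "is_subalgebra A B"
  shows "nonunital_algebra (A\<lparr>carrier := B\<rparr>)"
proof -
  have sub: "B \<subseteq> carrier A" and closed: "\<zero> \<in> B" "\<And>x y. x \<in> B \<Longrightarrow> y \<in> B \<Longrightarrow> x \<oplus> y \<in> B"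
    "\<And>c x. x \<in> B \<Longrightarrow> c \<odot> x \<in> B" "\<And>x y. x \<in> B \<Longrightarrow> y \<in> B \<Longrightarrow> x \<otimes> y \<in> B"
    using assms by (auto simp: is_subalgebra_def is_subspace_def)
  have "abelian_group (A\<lparr>carrier := B\<rparr>)"
  proof (rule abelian_groupI)
    fix x assume "x \<in> carrier (A\<lparr>carrier := B\<rparr>)"
    \<comment> \<open>\<open>is_subspace\<close> does not mention negation; additive inverses come
      from the scalar -1.\<close>
    then have "(- 1) \<odot> x \<in> B" "(- 1) \<odot> x \<oplus> x = \<zero>"
      using sub closed add_smult_minus_one[of x] a_comm[of x "(- 1) \<odot> x"] by auto
    then show "\<exists>y\<in>carrier (A\<lparr>carrier := B\<rparr>). y \<oplus>\<^bsub>A\<lparr>carrier := B\<rparr>\<^esub> x = \<zero>\<^bsub>A\<lparr>carrier := B\<rparr>\<^esub>"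
      by auto
  qed (use sub closed in \<open>auto simp: a_ac subset_iff\<close>)
  then show ?thesis
    unfolding nonunital_algebra_def nonunital_algebra_axioms_def
    using sub closed
    by (auto simp: subset_iff smult_l_distr smult_r_distr smult_assoc mult_assoc mult_l_distr
        mult_r_distr smult_mult_left smult_mult_right)
qed

lemma lin_independent_subalgebra:
  assumes "is_subalgebra A B" "I \<subseteq> B"
  shows "lin_independent (A\<lparr>carrier := B\<rparr>) I \<longleftrightarrow> lin_independent A I"
proof -
  interpret B: nonunital_algebra "A\<lparr>carrier := B\<rparr>" by (rule subalgebra_is_algebra[OF assms(1)])
  have sub: "B \<subseteq> carrier A" using assms(1) by (auto simp: is_subalgebra_def is_subspace_def)
  have "B.lincomb I c = lincomb I c" for c
  proof (cases "finite I")
    case True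
    then show ?thesis using assms(2)
    proof (induction I rule: finite_induct)
      case (insert x I)
      then show ?case using sub by (subst lincomb_insert, simp, simp, blast, subst B.lincomb_insert) auto
    qed simp
  next
    case False
    then show ?thesis by (simp add: lincomb_def B.lincomb_def finsum_infinite B.finsum_infinite)
  qed
  then show ?thesis by (simp add: lin_independent_altdef B.lin_independent_altdef)
qed

lemma lin_dim_subalgebra:
  assumes "is_subalgebra A B" "W \<subseteq> B"
  shows "lin_dim (A\<lparr>carrier := B\<rparr>) W = lin_dim A W"
proof -
  have "finite_basis (A\<lparr>carrier := B\<rparr>) W = finite_basis A W"
    unfolding finite_basis_def fun_eq_iff
    using lin_independent_subalgebra[OF assms(1)] assms(2) by auto
  then show ?thesis by (simp add: lin_dim_def)
qed

text \<open>Opens the choice in \<open>GKdim_fg\<close>: a finite basis \<open>S\<close> of the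
  chosen subspace describes the growth inside \<open>A\<close>. Nothing more is known about
  \<open>S\<close>, so every later estimate has to cope with an arbitrary finite generating
  set.\<close>

lemma GKdim_fg_subalgebra:
  assumes B: "is_subalgebra A B" "finitely_generated (A\<lparr>carrier := B\<rparr>)"
  obtains S where "finite S" "S \<subseteq> B" "generated_subalgebra A S = B"
    and "GKdim_fg (A\<lparr>carrier := B\<rparr>) =
      limsup (\<lambda>n. ereal (log (real n) (real (lin_dim A (lin_span A (power_gens A S n))))))"
proof -
  interpret B: nonunital_algebra "A\<lparr>carrier := B\<rparr>" by (rule subalgebra_is_algebra[OF B(1)])
  define V where "V = (SOME V. generating_subspace (A\<lparr>carrier := B\<rparr>) V)"
  have sub: "B \<subseteq> carrier A" using B(1) by (auto simp: is_subalgebra_def is_subspace_def)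
  obtain S0 where S0: "finite S0" "S0 \<subseteq> B" "generated_subalgebra A S0 = B"
    using B(2) by (auto simp: finitely_generated_def)
  \<comment> \<open>Some generating subspace exists, namely the span of a finite generating set;
    hence the one chosen by \<open>SOME\<close> is generating as well.\<close>
  have "generating_subspace (A\<lparr>carrier := B\<rparr>) (lin_span A S0)"
    unfolding generating_subspace_def is_subspace_def finite_dimensional_def
    using S0 B.finite_basis_exists[of S0] B.lin_span_closed[of _ S0]
    by (auto simp: generated_subalgebra_lin_span intro: lin_span.intros)
  then have V: "generating_subspace (A\<lparr>carrier := B\<rparr>) V"
    unfolding V_def by (rule someI)
  then obtain S where S: "finite_basis (A\<lparr>carrier := B\<rparr>) V S"
    by (auto simp: generating_subspace_def finite_dimensional_def)
  have fin: "finite S" and VS: "V = lin_span A S" and SB: "S \<subseteq> B"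
    using S V by (auto simp: finite_basis_def generating_subspace_def is_subspace_def)
  have gen: "generated_subalgebra A S = B"
    using V by (simp add: VS generating_subspace_def generated_subalgebra_lin_span)
  have "lin_span A (power_gens A S n) \<subseteq> B" for n
  proof -
    have "power_gens (A\<lparr>carrier := B\<rparr>) S n \<subseteq> B"
      using B.power_gens_closed[of S n] SB by simp
    then show ?thesis using B.lin_span_closed[of _ "power_gens A S n"]
      by (auto simp: power_gens_def)
  qed
  then have "GKdim_fg (A\<lparr>carrier := B\<rparr>) =
      limsup (\<lambda>n. ereal (log (real n) (real (lin_dim A (lin_span A (power_gens A S n))))))"
    using SB sub unfolding GKdim_fg_def Let_def V_def[symmetric]
    by (simp add: VS subspace_power_lin_span lin_dim_subalgebra[OF B(1)])
  with that fin SB gen show thesis by blast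
qed

section \<open>Bounds for the Gelfand-Kirillov dimension\<close>

lemma GKdim_nonneg: "0 \<le> GKdim A"
proof -
  let ?Z = "{\<zero>}"
  have Z: "is_subalgebra A ?Z" by (auto simp: is_subalgebra_def is_subspace_def)
  have "generated_subalgebra A {} = ?Z"
    using generated_subalgebra.zero[of A "{}"] is_subalgebra_generated
  proof (intro equalityI subsetI)
    fix x assume "x \<in> generated_subalgebra A {}"
    then show "x \<in> ?Z" by (induction rule: generated_subalgebra.induct) auto
  qed auto
  then have fg: "finitely_generated (A\<lparr>carrier := ?Z\<rparr>)"
    unfolding finitely_generated_def by (intro exI[of _ "{}"]) auto
  obtain S where "GKdim_fg (A\<lparr>carrier := ?Z\<rparr>) =
      limsup (\<lambda>n. ereal (log (real n) (real (lin_dim A (lin_span A (power_gens A S n))))))"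
    using GKdim_fg_subalgebra[OF Z fg] by metis
  also have "\<dots> \<ge> limsup (\<lambda>n. 0)"
  proof (rule Limsup_mono, rule eventually_mono[OF eventually_ge_at_top[of 2]])
    fix n :: nat assume "n \<ge> 2"
    then show "0 \<le> ereal (log (real n) (real (lin_dim A (lin_span A (power_gens A S n)))))"
      \<comment> \<open>Dimension 0 contributes 0 because \<open>ln 0 = 0\<close>; a positive
        dimension has a nonnegative logarithm.\<close>
      by (cases "lin_dim A (lin_span A (power_gens A S n)) = 0") (auto simp: log_def)
  qed
  finally have "0 \<le> GKdim_fg (A\<lparr>carrier := ?Z\<rparr>)" by (simp add: Limsup_const)
  then show ?thesis unfolding GKdim_def using Z fg by (intro SUP_upper2) auto
qed

text \<open>If dimensions are at most \<open>c * n ^ e\<close>, the logarithm to base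
  \<open>n\<close> is at most \<open>e\<close> plus a term tending to 0. The hypothesis asks for a
  constant per finite set only, as the supremum in \<open>GKdim\<close> is taken after the
  limit.\<close>

lemma GKdim_upper:
  fixes e :: nat
  assumes "\<And>S. finite S \<Longrightarrow> S \<subseteq> carrier A \<Longrightarrow>
    \<exists>c. \<forall>n>0. \<exists>D. finite D \<and> D \<subseteq> carrier A \<and> card D \<le> c * n ^ e \<and>
      power_gens A S n \<subseteq> lin_span A D"
  shows "GKdim A \<le> ereal (real e)"
  unfolding GKdim_def
proof (rule SUP_least)
  fix B assume "B \<in> {B. is_subalgebra A B \<and> finitely_generated (A\<lparr>carrier := B\<rparr>)}"
  then have B: "is_subalgebra A B" "finitely_generated (A\<lparr>carrier := B\<rparr>)" by auto
  obtain S where S: "finite S" "S \<subseteq> B" "generated_subalgebra A S = B" and eq: "GKdim_fg (A\<lparr>carrier := B\<rparr>) =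
      limsup (\<lambda>n. ereal (log (real n) (real (lin_dim A (lin_span A (power_gens A S n))))))"
    by (rule GKdim_fg_subalgebra[OF B])
  have SA: "S \<subseteq> carrier A" using S(2) B(1) by (auto simp: is_subalgebra_def is_subspace_def)
  obtain c0 where c0: "\<And>n. n > 0 \<Longrightarrow> \<exists>D. finite D \<and> D \<subseteq> carrier A \<and> card D \<le> c0 * n ^ e \<and>
      power_gens A S n \<subseteq> lin_span A D"
    using assms[OF S(1) SA] by blast
  \<comment> \<open>The successor makes \<open>c * n ^ e\<close> at least 1, so that the comparison
    of logarithms also covers dimension 0, where \<open>ln 0 = 0\<close>.\<close>
  define c where "c = real (Suc c0)"
  have c: "c > 0" by (simp add: c_def)
  have dim: "real (lin_dim A (lin_span A (power_gens A S n))) \<le> c * real n ^ e" if n: "n > 0" for n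
  proof -
    obtain D where D: "finite D" "D \<subseteq> carrier A" "card D \<le> c0 * n ^ e"
      "power_gens A S n \<subseteq> lin_span A D"
      using c0[OF n] by blast
    have "lin_dim A (lin_span A (power_gens A S n)) \<le> card D"
      using D S SA power_gens_closed finite_power_gens by (intro lin_dim_upper) auto
    also have "\<dots> \<le> Suc c0 * n ^ e" using D(3) by simp
    finally have "real (lin_dim A (lin_span A (power_gens A S n))) \<le> real (Suc c0 * n ^ e)"
      by (rule of_nat_mono)
    then show ?thesis by (simp add: c_def distrib_right)
  qed
  have "limsup (\<lambda>n. ereal (log (real n) (real (lin_dim A (lin_span A (power_gens A S n))))))
      \<le> limsup (\<lambda>n. ereal ((ln c + real e * ln (real n)) / ln (real n)))"
  proof (rule Limsup_mono, rule eventually_mono[OF eventually_ge_at_top[of 2]])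
    fix n :: nat assume n: "n \<ge> 2"
    let ?d = "real (lin_dim A (lin_span A (power_gens A S n)))"
    have c1: "c * real n ^ e \<ge> 1"
      using n by (simp add: c_def mult_ge1_I)
    have "ln ?d \<le> ln (c * real n ^ e)"
    proof (cases "?d = 0")
      case True
      then show ?thesis using c1 by simp
    next
      case False
      then show ?thesis using dim[of n] n by (intro ln_mono) auto
    qed
    also have "\<dots> = ln c + real e * ln (real n)"
      using n c by (simp add: ln_mult ln_realpow)
    finally show "ereal (log (real n) ?d) \<le> ereal ((ln c + real e * ln (real n)) / ln (real n))"
      using n by (simp add: log_def divide_right_mono)
  qed
  also have "\<dots> = ereal (real e)"
  proof (rule lim_imp_Limsup)
    have "(\<lambda>n. (ln c + real e * ln (real n)) / ln (real n)) \<longlonglongrightarrow> real e"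
      using c by real_asymp
    then show "(\<lambda>n. ereal ((ln c + real e * ln (real n)) / ln (real n))) \<longlonglongrightarrow> ereal (real e)"
      by simp
  qed simp
  finally show "GKdim_fg (A\<lparr>carrier := B\<rparr>) \<le> ereal (real e)" by (simp add: eq)
qed

text \<open>The subalgebra generated by \<open>F\<close> is tested. Its chosen generating set
  \<open>S\<close> reaches \<open>F\<close> with at most \<open>k\<close> factors, so products of
  \<open>d * q\<close> elements of \<open>F\<close> lie in the span of products of at most
  \<open>k * (d * q)\<close> elements of \<open>S\<close>.\<close>

lemma GKdim_lower:
  fixes m d :: nat
  assumes F: "finite F" "F \<subseteq> carrier A" and d: "d > 0"
    and I: "\<And>q. q > 0 \<Longrightarrow> \<exists>I \<subseteq> power_gens A F (d * q). lin_independent A I \<and> q ^ m \<le> card I"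
  shows "ereal (real m) \<le> GKdim A"
proof -
  define B where "B = generated_subalgebra A F"
  have B: "is_subalgebra A B" unfolding B_def using F(2) by (rule is_subalgebra_generated)
  have "F \<subseteq> B" by (auto simp: B_def intro: generated_subalgebra.incl)
  then have fg: "finitely_generated (A\<lparr>carrier := B\<rparr>)"
    unfolding finitely_generated_def using F by (intro exI[of _ F]) (auto simp: B_def)
  obtain S where S: "finite S" "S \<subseteq> B" "generated_subalgebra A S = B"
    and eq: "GKdim_fg (A\<lparr>carrier := B\<rparr>) =
      limsup (\<lambda>n. ereal (log (real n) (real (lin_dim A (lin_span A (power_gens A S n))))))"
    by (rule GKdim_fg_subalgebra[OF B fg])
  have SA: "S \<subseteq> carrier A" using S(2) B(1) by (auto simp: is_subalgebra_def is_subspace_def)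
  obtain k where k: "k > 0" "F \<subseteq> lin_span A (power_gens A S k)"
    using generated_subalgebra_exhaustion_finite[OF SA F(1)] \<open>F \<subseteq> B\<close> S(3) by blast
  define c where "c = real (k * d)"
  have c: "c > 0" using k d by (simp add: c_def)
  define X where "X n = ereal (log (real n) (real (lin_dim A (lin_span A (power_gens A S n)))))" for n
  \<comment> \<open>The dimension is bounded below only at these lengths, and a subsequence suffices
    for a limsup. The shift to \<open>Suc q\<close> meets the condition \<open>q > 0\<close> of the
    hypothesis.\<close>
  define \<rho> where "\<rho> q = k * (d * Suc q)" for q
  have mono: "strict_mono \<rho>" unfolding \<rho>_def using k d by (intro strict_monoI) auto
  have "(\<lambda>q. real m * ln (real (Suc q)) / ln (c * real (Suc q))) \<longlonglongrightarrow> real m"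
    using c by real_asymp
  then have "(\<lambda>q. ereal (real m * ln (real (Suc q)) / ln (c * real (Suc q)))) \<longlonglongrightarrow> ereal (real m)"
    by simp
  then have "ereal (real m) = limsup (\<lambda>q. ereal (real m * ln (real (Suc q)) / ln (c * real (Suc q))))"
    by (intro lim_imp_Limsup[symmetric]) simp_all
  also have "\<dots> \<le> limsup (X \<circ> \<rho>)"
  proof (rule Limsup_mono, rule eventually_mono[OF eventually_ge_at_top[of 1]])
    fix q :: nat assume q: "q \<ge> 1"
    let ?D = "lin_dim A (lin_span A (power_gens A S (\<rho> q)))"
    obtain I where I: "I \<subseteq> power_gens A F (d * Suc q)" "lin_independent A I" "Suc q ^ m \<le> card I"
      using I[of "Suc q"] by auto
    have "card I \<le> ?D"
      using power_gens_in_lin_span[OF SA k(2)] I SA S(1) power_gens_closed finite_power_gens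
      unfolding \<rho>_def by (intro lin_dim_lower) blast+
    then have D: "real (Suc q) ^ m \<le> real ?D"
      using I(3) by (metis (no_types, lifting) of_nat_mono of_nat_power order_trans)
    then have "ln (real (Suc q) ^ m) \<le> ln (real ?D)"
      by (intro ln_mono) (auto intro: less_le_trans[of 0 "real (Suc q) ^ m"])
    moreover have "ln (real (\<rho> q)) > 0"
    proof -
      have "1 * (1 * 2) \<le> \<rho> q" unfolding \<rho>_def using k d q by (intro mult_le_mono) auto
      then show ?thesis by simp
    qed
    moreover have "real (\<rho> q) = c * real (Suc q)" by (simp add: \<rho>_def c_def algebra_simps)
    ultimately show "ereal (real m * ln (real (Suc q)) / ln (c * real (Suc q))) \<le> (X \<circ> \<rho>) q"
      by (simp add: X_def log_def ln_realpow divide_right_mono)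
  qed
  also have "\<dots> \<le> limsup X" using mono by (rule limsup_subseq_mono)
  also have "\<dots> = GKdim_fg (A\<lparr>carrier := B\<rparr>)" by (simp add: eq X_def[abs_def])
  also have "\<dots> \<le> GKdim A" unfolding GKdim_def using B fg by (intro SUP_upper) auto
  finally show ?thesis .
qed

end

section \<open>Presented algebras\<close>

abbreviation word :: "'x list \<Rightarrow> ('x free_monoid \<Rightarrow>\<^sub>0 'k::field)" where
  "word u \<equiv> Poly_Mapping.single (Word u) 1"

lemma word_mult: "word u * word v = word (u @ v)"
  by (simp add: mult_single plus_free_monoid_def)

lemma word_Nil [simp]: "word [] = 1"
  by (simp flip: zero_free_monoid_def)

lemma letters_plus [simp]: "letters (u + v) = letters u @ letters v"
  by (simp add: plus_free_monoid_def)

lemma letters_zero [simp]: "letters 0 = []"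
  by (simp add: zero_free_monoid_def)

lemma poly_mapping_expansion:
  "f = (\<Sum>k\<in>Poly_Mapping.keys f. Poly_Mapping.single k (Poly_Mapping.lookup f k))"
  by (rule poly_mapping_eqI)
    (auto simp: lookup_sum lookup_single when_def in_keys_iff)

text \<open>A multiple of the empty word. For nonzero \<open>c\<close> it lies outside the free
  algebra without unit, but multiplying by it in the monoid ring is scalar multiplication, so
  scalars obey the ring laws.\<close>

abbreviation scal :: "'k::field \<Rightarrow> ('x free_monoid \<Rightarrow>\<^sub>0 'k)" where
  "scal c \<equiv> Poly_Mapping.single 0 c"

lemma scal_commute:
  fixes f g :: "'x free_monoid \<Rightarrow>\<^sub>0 'k::field"
  shows "f * (scal c * g) = scal c * (f * g)"
proof -
  have "(\<Sum>k\<in>K. Poly_Mapping.single k (a k)) * scal c = scal c * (\<Sum>k\<in>K. Poly_Mapping.single k (a k))"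
    for K :: "'x free_monoid set" and a
    by (simp add: sum_distrib_left sum_distrib_right mult_single mult.commute)
  from this[of "Poly_Mapping.lookup f" "Poly_Mapping.keys f"] have "f * scal c = scal c * f"
    by (simp flip: poly_mapping_expansion)
  then show ?thesis by (simp flip: mult.assoc)
qed

lemma scal_scal: "scal c * (scal d * f) = scal (c * d) * f"
  by (simp add: mult_single flip: mult.assoc)

lemma keys_scal_mult: "Poly_Mapping.keys (scal c * f) \<subseteq> Poly_Mapping.keys f"
  using keys_mult[of "scal c" f] by (auto split: if_splits)

lemma free_algebra_simps [simp]:
  "x \<otimes>\<^bsub>free_algebra X\<^esub> y = x * y" "x \<oplus>\<^bsub>free_algebra X\<^esub> y = x + y"
  "\<zero>\<^bsub>free_algebra X\<^esub> = 0" "c \<odot>\<^bsub>free_algebra X\<^esub> x = scal c * x"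
  by (simp_all add: free_algebra_def mult_map_scale_conv_mult)

lemma free_algebra_carrier:
  "f \<in> carrier (free_algebra X) \<longleftrightarrow>
    (\<forall>w\<in>Poly_Mapping.keys f. letters w \<noteq> [] \<and> set (letters w) \<subseteq> X)"
  by (simp add: free_algebra_def)

lemma free_algebra_zero_closed: "0 \<in> carrier (free_algebra X)"
  by (simp add: free_algebra_carrier)

lemma free_algebra_add_closed:
  "f \<in> carrier (free_algebra X) \<Longrightarrow> g \<in> carrier (free_algebra X) \<Longrightarrow>
    f + g \<in> carrier (free_algebra X)"
  using keys_add[of f g] unfolding free_algebra_carrier by blast

lemma free_algebra_mult_closed:
  "f \<in> carrier (free_algebra X) \<Longrightarrow> g \<in> carrier (free_algebra X) \<Longrightarrow>
    f * g \<in> carrier (free_algebra X)"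
  using keys_mult[of f g] unfolding free_algebra_carrier by fastforce

lemma free_algebra_scal_closed:
  "f \<in> carrier (free_algebra X) \<Longrightarrow> scal c * f \<in> carrier (free_algebra X)"
  using keys_scal_mult[of c f] unfolding free_algebra_carrier by blast

lemma free_algebra_uminus_closed:
  "f \<in> carrier (free_algebra X) \<Longrightarrow> - f \<in> carrier (free_algebra X)"
  using free_algebra_scal_closed[of f X "- 1"] by (simp add: single_uminus)

lemma free_algebra_diff_closed:
  "f \<in> carrier (free_algebra X) \<Longrightarrow> g \<in> carrier (free_algebra X) \<Longrightarrow>
    f - g \<in> carrier (free_algebra X)"
  using free_algebra_add_closed[of f X "- g"] free_algebra_uminus_closed[of g X] by simp

lemmas free_algebra_closed = free_algebra_zero_closed free_algebra_add_closed
  free_algebra_mult_closed free_algebra_scal_closed free_algebra_uminus_closed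
  free_algebra_diff_closed

lemma word_in_free_algebra [simp]:
  "word u \<in> carrier (free_algebra X) \<longleftrightarrow> u \<noteq> [] \<and> set u \<subseteq> X"
  by (simp add: free_algebra_carrier)

section \<open>The quotient by the ideal of relations\<close>

locale presentation =
  fixes X :: "'x set" and R :: "('x free_monoid \<Rightarrow>\<^sub>0 'k::field) set"
  assumes relations_closed: "R \<subseteq> carrier (free_algebra X)"
begin

abbreviation "L \<equiv> presented_algebra X R"
abbreviation "J \<equiv> generated_ideal (free_algebra X) R"

definition cls :: "('x free_monoid \<Rightarrow>\<^sub>0 'k) \<Rightarrow> ('x free_monoid \<Rightarrow>\<^sub>0 'k) set" where
  "cls f = (\<lambda>i. i + f) ` J"

lemma J_closed: "f \<in> J \<Longrightarrow> f \<in> carrier (free_algebra X)"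
  by (induction rule: generated_ideal.induct)
    (use relations_closed free_algebra_closed in auto)

lemma J_zero: "0 \<in> J"
  using generated_ideal.zero[of "free_algebra X" R] by simp

lemma J_add: "f \<in> J \<Longrightarrow> g \<in> J \<Longrightarrow> f + g \<in> J"
  using generated_ideal.add[of f "free_algebra X" R g] by simp

lemma J_scal: "f \<in> J \<Longrightarrow> scal c * f \<in> J"
  using generated_ideal.smult[of f "free_algebra X" R c] by simp

lemma J_uminus: "f \<in> J \<Longrightarrow> - f \<in> J"
  using J_scal[of f "- 1"] by (simp add: single_uminus)

lemma J_mult_left: "a \<in> carrier (free_algebra X) \<Longrightarrow> f \<in> J \<Longrightarrow> a * f \<in> J"
  using generated_ideal.mult_left[of a "free_algebra X" f R] by simp

lemma J_mult_right: "a \<in> carrier (free_algebra X) \<Longrightarrow> f \<in> J \<Longrightarrow> f * a \<in> J"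
  using generated_ideal.mult_right[of a "free_algebra X" f R] by simp

lemma cls_eq_iff: "cls f = cls g \<longleftrightarrow> f - g \<in> J"
proof
  assume "cls f = cls g"
  moreover have "f \<in> cls f" unfolding cls_def using J_zero by force
  ultimately obtain i where "i \<in> J" "f = i + g" unfolding cls_def by blast
  then show "f - g \<in> J" by simp
next
  have sub: "cls a \<subseteq> cls b" if "a - b \<in> J" for a b
  proof
    fix x assume "x \<in> cls a"
    then obtain i where i: "i \<in> J" "x = i + a" unfolding cls_def by blast
    then have "x = (i + (a - b)) + b" by simp
    then show "x \<in> cls b" unfolding cls_def using J_add[OF i(1) that] by blast
  qed
  assume "f - g \<in> J"
  moreover from this have "g - f \<in> J" using J_uminus[of "f - g"] by simp
  ultimately show "cls f = cls g" using sub by blast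
qed

lemma mem_cls_iff: "x \<in> cls f \<longleftrightarrow> x - f \<in> J"
  unfolding cls_def by (auto simp: image_iff) (metis diff_add_cancel)

lemma cls_self: "f \<in> cls f"
  by (simp add: mem_cls_iff J_zero)

lemma coset_eq_cls: "J +>\<^bsub>free_algebra X\<^esub> f = cls f"
  unfolding a_r_coset_def r_coset_def cls_def by auto

lemma L_carrier: "carrier L = cls ` carrier (free_algebra X)"
  unfolding presented_algebra_def quotient_algebra_def
  by (auto simp: A_RCOSETS_def' coset_eq_cls)

lemma L_zero: "\<zero>\<^bsub>L\<^esub> = cls 0"
  unfolding presented_algebra_def quotient_algebra_def by (simp add: cls_def)

lemma L_add: "cls f \<oplus>\<^bsub>L\<^esub> cls g = cls (f + g)"
proof -
  have "set_add (free_algebra X) (cls f) (cls g) = cls (f + g)"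
  proof (intro equalityI subsetI)
    fix x assume "x \<in> set_add (free_algebra X) (cls f) (cls g)"
    then obtain a b where "a - f \<in> J" "b - g \<in> J" "x = a + b"
      by (auto simp: set_add_def' mem_cls_iff)
    then show "x \<in> cls (f + g)" using J_add[of "a - f" "b - g"] by (simp add: mem_cls_iff algebra_simps)
  next
    fix x assume "x \<in> cls (f + g)"
    then have "x - g \<in> cls f" "x = (x - g) + g" by (auto simp: mem_cls_iff algebra_simps)
    then show "x \<in> set_add (free_algebra X) (cls f) (cls g)"
      unfolding set_add_def' using cls_self[of g] by fastforce
  qed
  then show ?thesis unfolding presented_algebra_def quotient_algebra_def by simp
qed

lemma L_mult:
  assumes "f \<in> carrier (free_algebra X)" "g \<in> carrier (free_algebra X)"
  shows "cls f \<otimes>\<^bsub>L\<^esub> cls g = cls (f * g)"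
proof -
  have "cls (a * b) = cls (f * g)" if "a \<in> cls f" "b \<in> cls g" for a b
  proof -
    have ab: "a - f \<in> J" "b - g \<in> J" using that by (auto simp: mem_cls_iff)
    \<comment> \<open>The ideal absorbs only factors from the carrier; a representative differs from
      \<open>f\<close> by an element of the ideal, so it stays there.\<close>
    then have "a = (a - f) + f" "a - f \<in> carrier (free_algebra X)" by (auto simp: J_closed)
    then have "a \<in> carrier (free_algebra X)" using assms(1) free_algebra_add_closed by metis
    then have "a * (b - g) + (a - f) * g \<in> J"
      using ab assms(2) by (intro J_add J_mult_left J_mult_right) auto
    then show ?thesis by (simp add: cls_eq_iff algebra_simps)
  qed
  then have "rcoset_mult (free_algebra X) J (cls f) (cls g) =
      (\<Union>a\<in>cls f. \<Union>b\<in>cls g. cls (f * g))"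
    unfolding rcoset_mult_def coset_eq_cls by (intro SUP_cong refl) auto
  also have "\<dots> = cls (f * g)"
    using cls_self[of f] cls_self[of g] by (subst UN_constant, subst UN_constant) auto
  finally have "rcoset_mult (free_algebra X) J (cls f) (cls g) = cls (f * g)" .
  then show ?thesis unfolding presented_algebra_def quotient_algebra_def by simp
qed

lemma L_smult: "c \<odot>\<^bsub>L\<^esub> cls f = cls (scal c * f)"
proof -
  have "cls (scal c * a) = cls (scal c * f)" if "a \<in> cls f" for a
    using J_scal[of "a - f" c] that by (simp add: cls_eq_iff mem_cls_iff algebra_simps)
  then have "(\<Union>x\<in>cls f. J +>\<^bsub>free_algebra X\<^esub> (scal c * x)) = cls (scal c * f)"
    unfolding coset_eq_cls using cls_self[of f] by (intro equalityI UN_least) blast+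
  then show ?thesis unfolding presented_algebra_def quotient_algebra_def by simp
qed

lemmas L_simps = L_zero L_add L_mult L_smult

sublocale nonunital_algebra L
proof -
  have "abelian_group L"
  proof (rule abelian_groupI)
    fix x assume "x \<in> carrier L"
    then obtain f where "f \<in> carrier (free_algebra X)" "x = cls f" by (auto simp: L_carrier)
    then have "cls (0 - f) \<in> carrier L" "cls (0 - f) \<oplus>\<^bsub>L\<^esub> x = \<zero>\<^bsub>L\<^esub>"
      unfolding L_carrier by (auto simp: L_simps intro!: imageI free_algebra_closed)
    then show "\<exists>y\<in>carrier L. y \<oplus>\<^bsub>L\<^esub> x = \<zero>\<^bsub>L\<^esub>" by blast
  qed (auto simp: L_carrier L_simps algebra_simps intro!: imageI free_algebra_closed)
  then show "nonunital_algebra L"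
    unfolding nonunital_algebra_def nonunital_algebra_axioms_def
    by (auto simp: L_carrier L_simps free_algebra_closed single_add distrib_left distrib_right
        scal_scal mult.assoc intro!: imageI) (simp_all only: scal_commute)
qed

lemma cls_closed [simp]: "f \<in> carrier (free_algebra X) \<Longrightarrow> cls f \<in> carrier L"
  by (simp add: L_carrier)

lemma cls_in_lin_span:
  "cls (\<Sum>k\<in>K. Poly_Mapping.single k (a k)) \<in> lin_span L ((\<lambda>k. cls (word (letters k))) ` K)"
proof (induction K rule: infinite_finite_induct)
  case (insert k K)
  have "Poly_Mapping.single k (a k) = scal (a k) * word (letters k)" by (simp add: mult_single)
  then have "cls (\<Sum>j\<in>insert k K. Poly_Mapping.single j (a j)) =
      a k \<odot>\<^bsub>L\<^esub> cls (word (letters k)) \<oplus>\<^bsub>L\<^esub> cls (\<Sum>j\<in>K. Poly_Mapping.single j (a j))"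
    using insert by (simp add: L_simps)
  moreover have "cls (\<Sum>j\<in>K. Poly_Mapping.single j (a j))
      \<in> lin_span L ((\<lambda>k. cls (word (letters k))) ` insert k K)"
    using insert.IH lin_span_mono[of "(\<lambda>k. cls (word (letters k))) ` K"
        "(\<lambda>k. cls (word (letters k))) ` insert k K"] by auto
  ultimately show ?case by (simp add: lin_span.add lin_span.smult lin_span.incl)
qed (auto simp flip: L_zero intro: lin_span.zero)

section \<open>Spans of words in finitely many generators\<close>

definition words :: "'x set \<Rightarrow> nat \<Rightarrow> ('x free_monoid \<Rightarrow>\<^sub>0 'k) set set" where
  "words F n = {cls (word u) | u. u \<noteq> [] \<and> set u \<subseteq> F \<and> length u \<le> n}"

lemma words_mono: "F \<subseteq> F' \<Longrightarrow> m \<le> n \<Longrightarrow> words F m \<subseteq> words F' n"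
  unfolding words_def by fastforce

lemma words_closed: "F \<subseteq> X \<Longrightarrow> words F n \<subseteq> carrier L"
  unfolding words_def by auto

lemma words_mult:
  assumes "F \<subseteq> X" "x \<in> words F m" "y \<in> words F n"
  shows "x \<otimes>\<^bsub>L\<^esub> y \<in> words F (m + n)"
proof -
  obtain u v where u: "x = cls (word u)" "u \<noteq> []" "set u \<subseteq> F" "length u \<le> m"
    and v: "y = cls (word v)" "v \<noteq> []" "set v \<subseteq> F" "length v \<le> n"
    using assms(2,3) unfolding words_def by blast
  have "x \<otimes>\<^bsub>L\<^esub> y = cls (word (u @ v))"
    using u v assms(1) by (simp add: L_mult word_mult)
  moreover have "set (u @ v) \<subseteq> F" "length (u @ v) \<le> m + n" "u @ v \<noteq> []" using u v by auto
  ultimately show ?thesis unfolding words_def by blast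
qed

lemma lin_span_words_mult:
  assumes "F \<subseteq> X" "x \<in> lin_span L (words F m)" "y \<in> lin_span L (words F n)"
  shows "x \<otimes>\<^bsub>L\<^esub> y \<in> lin_span L (words F (m + n))"
  using _ words_closed[OF assms(1)] words_closed[OF assms(1)] assms(2,3)
proof (rule lin_span_mult)
  fix s t assume "s \<in> words F m" "t \<in> words F n"
  then show "s \<otimes>\<^bsub>L\<^esub> t \<in> lin_span L (words F (m + n))"
    by (rule lin_span.incl[OF words_mult[OF assms(1)]])
qed

text \<open>A representative has finite support, so it involves finitely many letters; the sum of
  the lengths of its words is a crude common bound on them.\<close>

lemma in_lin_span_words:
  assumes "x \<in> carrier L"
  shows "\<exists>F \<subseteq> X. finite F \<and> (\<exists>l. x \<in> lin_span L (words F l))"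
proof -
  obtain f where f: "f \<in> carrier (free_algebra X)" "x = cls f" using assms by (auto simp: L_carrier)
  let ?K = "Poly_Mapping.keys f"
  let ?F = "\<Union>k\<in>?K. set (letters k)" and ?l = "\<Sum>k\<in>?K. length (letters k)"
  have x: "x \<in> lin_span L ((\<lambda>k. cls (word (letters k))) ` ?K)"
    using cls_in_lin_span[of "Poly_Mapping.lookup f" ?K] f(2) by (simp flip: poly_mapping_expansion)
  have "(\<lambda>k. cls (word (letters k))) ` ?K \<subseteq> words ?F ?l"
  proof (rule image_subsetI)
    fix k assume k: "k \<in> ?K"
    then have "letters k \<noteq> []" "set (letters k) \<subseteq> ?F" "length (letters k) \<le> ?l"
      using f(1) by (auto simp: free_algebra_carrier intro: member_le_sum)
    then show "cls (word (letters k)) \<in> words ?F ?l" unfolding words_def by blast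
  qed
  then have "x \<in> lin_span L (words ?F ?l)" using x lin_span_mono by blast
  moreover have "?F \<subseteq> X" using f(1) by (auto simp: free_algebra_carrier)
  ultimately show ?thesis by (intro exI[of _ ?F]) auto
qed

lemma finite_in_lin_span_words:
  assumes "finite S" "S \<subseteq> carrier L"
  shows "\<exists>F \<subseteq> X. finite F \<and> (\<exists>l>0. S \<subseteq> lin_span L (words F l))"
  using assms
proof (induction S rule: finite_induct)
  case empty
  then show ?case by auto
next
  case (insert x S)
  then obtain F l where F: "F \<subseteq> X" "finite F" "l > 0" "S \<subseteq> lin_span L (words F l)" by auto
  obtain F' l' where F': "F' \<subseteq> X" "finite F'" "x \<in> lin_span L (words F' l')"
    using in_lin_span_words[of x] insert.prems by auto
  have "lin_span L (words F l) \<subseteq> lin_span L (words (F \<union> F') (l + l'))"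
    "lin_span L (words F' l') \<subseteq> lin_span L (words (F \<union> F') (l + l'))"
    by (intro lin_span_mono words_mono; simp)+
  then show ?case using F F' by (intro exI[of _ "F \<union> F'"]) (auto intro!: exI[of _ "l + l'"])
qed

lemma power_gens_in_lin_span_words:
  assumes "F \<subseteq> X" "S \<subseteq> lin_span L (words F l)"
  shows "power_gens L S n \<subseteq> lin_span L (words F (l * n))"
proof
  fix z assume "z \<in> power_gens L S n"
  then obtain x xs where z: "z = foldl (\<otimes>\<^bsub>L\<^esub>) x xs" "x \<in> S" "set xs \<subseteq> S" "length xs < n"
    unfolding power_gens_def by blast
  have "foldl (\<otimes>\<^bsub>L\<^esub>) x xs \<in> lin_span L (words F (l + l * length xs))"
    using z(3)
  proof (induction xs rule: rev_induct)
    case Nil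
    then show ?case using z(2) assms(2) by auto
  next
    case (snoc y ys)
    then have "foldl (\<otimes>\<^bsub>L\<^esub>) x ys \<otimes>\<^bsub>L\<^esub> y \<in> lin_span L (words F (l + l * length ys + l))"
      using assms by (intro lin_span_words_mult) auto
    then show ?case by (simp add: ac_simps)
  qed
  moreover have "l + l * length xs \<le> l * n"
    using z(4) by (metis Suc_leI mult_Suc_right mult_le_mono2)
  ultimately show "z \<in> lin_span L (words F (l * n))"
    using z(1) lin_span_mono[OF words_mono[OF order_refl]] by blast
qed

text \<open>Reduces arbitrary finite subsets to finite sets of letters: elements of \<open>S\<close>
  are combinations of words of length at most \<open>l\<close>, which only multiplies the constant
  by \<open>l ^ e\<close>.\<close>

lemma GKdim_upper_words:
  fixes e :: nat
  assumes "\<And>F. finite F \<Longrightarrow> F \<subseteq> X \<Longrightarrow> \<exists>c. \<forall>n>0. \<exists>D. finite D \<and> D \<subseteq> carrier L \<and>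
    card D \<le> c * n ^ e \<and> words F n \<subseteq> lin_span L D"
  shows "GKdim L \<le> ereal (real e)"
proof (rule GKdim_upper)
  fix S assume "finite S" "S \<subseteq> carrier L"
  then obtain F l where F: "F \<subseteq> X" "finite F" "l > 0" "S \<subseteq> lin_span L (words F l)"
    using finite_in_lin_span_words[of S] by blast
  obtain c where c: "\<And>n. n > 0 \<Longrightarrow> \<exists>D. finite D \<and> D \<subseteq> carrier L \<and>
    card D \<le> c * n ^ e \<and> words F n \<subseteq> lin_span L D"
    using assms[OF F(2,1)] by blast
  have "\<exists>D. finite D \<and> D \<subseteq> carrier L \<and> card D \<le> c * l ^ e * n ^ e \<and> power_gens L S n \<subseteq> lin_span L D"
    if n: "n > 0" for n
  proof -
    obtain D where D: "finite D" "D \<subseteq> carrier L" "card D \<le> c * (l * n) ^ e"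
      "words F (l * n) \<subseteq> lin_span L D"
      using c[of "l * n"] n F(3) by auto
    have "power_gens L S n \<subseteq> lin_span L D"
      using power_gens_in_lin_span_words[OF F(1,4), of n] lin_span_minimal[OF _ D(4)] by blast
    then show ?thesis using D by (intro exI[of _ D]) (auto simp: power_mult_distrib mult.assoc)
  qed
  then show "\<exists>c. \<forall>n>0. \<exists>D. finite D \<and> D \<subseteq> carrier L \<and> card D \<le> c * n ^ e \<and>
      power_gens L S n \<subseteq> lin_span L D" by blast
qed

lemma cls_word_in_power_gens:
  assumes "u \<noteq> []" "set u \<subseteq> F" "F \<subseteq> X" "length u \<le> n"
  shows "cls (word u) \<in> power_gens L ((\<lambda>x. cls (word [x])) ` F) n"
proof -
  obtain a v where u: "u = a # v" using assms(1) by (cases u) auto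
  have "cls (word (a # v)) = foldl (\<otimes>\<^bsub>L\<^esub>) (cls (word [a])) (map (\<lambda>x. cls (word [x])) v)"
    if "set (a # v) \<subseteq> X"
    using that
  proof (induction v rule: rev_induct)
    case (snoc y ys)
    have "cls (word (a # ys @ [y])) = cls (word (a # ys)) \<otimes>\<^bsub>L\<^esub> cls (word [y])"
      using snoc.prems by (subst L_mult) (auto simp: word_mult)
    then show ?case using snoc by simp
  qed simp
  moreover have "set u \<subseteq> X" using assms by auto
  ultimately show ?thesis unfolding power_gens_def using u assms by fastforce
qed

end

subsection \<open>Representations by partial maps\<close>

context
  fixes p :: "'x \<Rightarrow> 'b \<Rightarrow> 'b option"
begin

text \<open>Letters are applied to a state from the left. Pulling functions back reverses
  composition, so that the product of words becomes the composite of operators in the same order, as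
  \<open>act_mult\<close> records.\<close>

fun pull :: "'x list \<Rightarrow> 'b \<Rightarrow> 'b option" where
  "pull [] b = Some b"
| "pull (x # xs) b = Option.bind (p x b) (pull xs)"

lemma pull_append: "pull (u @ v) b = Option.bind (pull u b) (pull v)"
  by (induction u arbitrary: b) (auto simp: Option.bind_assoc split: Option.bind_split)

definition pull_back :: "'x list \<Rightarrow> ('b \<Rightarrow> 'k) \<Rightarrow> 'b \<Rightarrow> 'k::field" where
  "pull_back u h b = (case pull u b of None \<Rightarrow> 0 | Some b' \<Rightarrow> h b')"

definition act :: "('x free_monoid \<Rightarrow>\<^sub>0 'k) \<Rightarrow> ('b \<Rightarrow> 'k) \<Rightarrow> 'b \<Rightarrow> 'k::field" where
  "act f h b = (\<Sum>w\<in>Poly_Mapping.keys f. Poly_Mapping.lookup f w * pull_back (letters w) h b)"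

lemma act_superset:
  "finite K \<Longrightarrow> Poly_Mapping.keys f \<subseteq> K \<Longrightarrow>
    act f h b = (\<Sum>w\<in>K. Poly_Mapping.lookup f w * pull_back (letters w) h b)"
  unfolding act_def by (rule sum.mono_neutral_left) (auto simp: in_keys_iff)

lemma act_add: "act (f + g) h b = act f h b + act g h b"
proof -
  let ?K = "Poly_Mapping.keys f \<union> Poly_Mapping.keys g"
  have "Poly_Mapping.keys (f + g) \<subseteq> ?K" by (rule keys_add)
  then show ?thesis
    by (simp add: act_superset[of ?K] lookup_add distrib_right sum.distrib)
qed

lemma act_zero [simp]: "act 0 h b = 0"
  by (simp add: act_def)

lemma act_uminus: "act (- f) h b = - act f h b"
  using act_add[of f "- f" h b] by (simp add: eq_neg_iff_add_eq_0 add.commute)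

lemma act_diff: "act (f - g) h b = act f h b - act g h b"
  using act_add[of f "- g" h b] by (simp add: act_uminus)

lemma act_sum: "act (\<Sum>i\<in>I. f i) h b = (\<Sum>i\<in>I. act (f i) h b)"
  by (induction I rule: infinite_finite_induct) (auto simp: act_add)

lemma act_single: "act (Poly_Mapping.single w c) h b = c * pull_back (letters w) h b"
  by (simp add: act_def)

lemma act_mult: "act (f * g) h b = act f (act g h) b"
proof -
  have single: "act (Poly_Mapping.single v c * g) h b = c * pull_back (letters v) (act g h) b" for v c
  proof -
    have "act (Poly_Mapping.single v c * (\<Sum>k\<in>K. Poly_Mapping.single k (a k))) h b =
        c * pull_back (letters v) (act (\<Sum>k\<in>K. Poly_Mapping.single k (a k)) h) b" for K a
      by (auto simp: sum_distrib_left mult_single act_sum act_single pull_back_def pull_append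
          mult.assoc split: option.splits)
    from this[of "Poly_Mapping.lookup g" "Poly_Mapping.keys g"] show ?thesis
      by (simp flip: poly_mapping_expansion)
  qed
  have "act ((\<Sum>k\<in>K. Poly_Mapping.single k (a k)) * g) h b =
      act (\<Sum>k\<in>K. Poly_Mapping.single k (a k)) (act g h) b" for K a
    by (simp add: sum_distrib_right act_sum act_single single)
  from this[of "Poly_Mapping.lookup f" "Poly_Mapping.keys f"] show ?thesis
    by (simp flip: poly_mapping_expansion)
qed

lemma act_zero_fun [simp]: "act f (\<lambda>b. 0) b = 0"
  by (auto simp: act_def pull_back_def split: option.splits intro!: sum.neutral)

text \<open>The elements acting as zero form a two-sided ideal. The function \<open>h\<close> is
  generalised because a factor on the right changes the function that is acted upon.\<close>

lemma act_generated_ideal: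
  assumes "\<And>f h b. f \<in> R \<Longrightarrow> act f h b = 0" "f \<in> generated_ideal (free_algebra X) R"
  shows "act f h b = 0"
  using assms(2)
proof (induction arbitrary: h b rule: generated_ideal.induct)
  case (mult_left a x)
  then have "act x h = (\<lambda>b. 0)" by auto
  then show ?case by (simp add: act_mult)
qed (auto simp: assms(1) act_add act_mult act_single pull_back_def)

end

text \<open>Applying a combination to the indicator function of \<open>b'\<close> and evaluating at
  \<open>b\<close> reads off the coefficient of \<open>u\<close>, since no other word of
  \<open>U\<close> leads from \<open>b\<close> to \<open>b'\<close>.\<close>

lemma (in presentation) lin_independent_words:
  assumes R: "\<And>f h b. f \<in> R \<Longrightarrow> act p f h b = 0"
    and U: "finite U" "[] \<notin> U" "\<And>u. u \<in> U \<Longrightarrow> set u \<subseteq> X"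
    and sep: "\<And>u. u \<in> U \<Longrightarrow> \<exists>b b'. \<forall>v\<in>U. pull p v b = Some b' \<longleftrightarrow> v = u"
  shows "lin_independent L ((\<lambda>u. cls (word u)) ` U)" "inj_on (\<lambda>u. cls (word u)) U"
proof -
  have coeff: "c u = 0" if c: "(\<Sum>v\<in>U. scal (c v) * word v) \<in> J" and u: "u \<in> U" for c u
  proof -
    obtain b b' where b: "\<And>v. v \<in> U \<Longrightarrow> pull p v b = Some b' \<longleftrightarrow> v = u" using sep[OF u] by blast
    let ?h = "\<lambda>x. if x = b' then 1 else 0 :: 'k"
    have eval: "pull_back p v ?h b = (if v = u then 1 else 0)" if "v \<in> U" for v
      using b[OF that] by (cases "pull p v b") (auto simp: pull_back_def)
    have "0 = act p (\<Sum>v\<in>U. scal (c v) * word v) ?h b"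
      by (rule act_generated_ideal[OF R c, symmetric])
    also have "\<dots> = (\<Sum>v\<in>U. c v * pull_back p v ?h b)"
      by (simp add: act_sum mult_single act_single)
    also have "\<dots> = (\<Sum>v\<in>U. if v = u then c v else 0)"
      by (intro sum.cong) (auto simp: eval)
    also have "\<dots> = c u" using U(1) u by simp
    finally show ?thesis by simp
  qed
  \<comment> \<open>Independence is stated for a set of classes, in which equal classes would merge;
    so distinct words are first shown to have distinct classes.\<close>
  show inj: "inj_on (\<lambda>u. cls (word u)) U"
  proof (rule inj_onI, rule ccontr)
    fix u v assume uv: "u \<in> U" "v \<in> U" "cls (word u) = cls (word v)" "u \<noteq> v"
    let ?c = "\<lambda>w. if w = u then 1 else if w = v then - 1 else 0 :: 'k"
    have "(\<Sum>w\<in>U. scal (?c w) * word w) = (\<Sum>w\<in>{u, v}. scal (?c w) * word w)"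
      using U(1) uv by (intro sum.mono_neutral_right) auto
    also have "\<dots> = word u - word v" using uv by (simp add: mult_single single_uminus)
    finally have "(\<Sum>w\<in>U. scal (?c w) * word w) \<in> J" using uv by (simp add: cls_eq_iff)
    from coeff[OF this uv(1)] show False by simp
  qed
  show "lin_independent L ((\<lambda>u. cls (word u)) ` U)"
    unfolding lin_independent_altdef
  proof (intro allI impI ballI)
    fix c x assume c: "lincomb ((\<lambda>u. cls (word u)) ` U) c = \<zero>\<^bsub>L\<^esub>" and x: "x \<in> (\<lambda>u. cls (word u)) ` U"
    define d where "d u = c (cls (word u))" for u
    have "lincomb ((\<lambda>u. cls (word u)) ` W) c = cls (\<Sum>u\<in>W. scal (d u) * word u)" if "W \<subseteq> U" for W
      using finite_subset[OF that U(1)] that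
    proof (induction W rule: finite_induct)
      case (insert u W)
      have "cls (word u) \<notin> (\<lambda>u. cls (word u)) ` W"
        using insert inj by (auto dest: inj_onD)
      then have "lincomb ((\<lambda>u. cls (word u)) ` insert u W) c =
          c (cls (word u)) \<odot>\<^bsub>L\<^esub> cls (word u) \<oplus>\<^bsub>L\<^esub> lincomb ((\<lambda>u. cls (word u)) ` W) c"
        unfolding image_insert using insert U
        by (intro lincomb_insert) (auto intro!: cls_closed simp: word_in_free_algebra)
      then show ?case using insert by (simp add: L_simps d_def)
    qed (simp add: L_zero)
    then have "cls (\<Sum>u\<in>U. scal (d u) * word u) = cls 0" using c by (simp add: L_zero)
    then have "(\<Sum>u\<in>U. scal (d u) * word u) \<in> J" by (simp add: cls_eq_iff)
    then have "d u = 0" if "u \<in> U" for u using coeff that by blast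
    then show "c x = 0" using x by (auto simp: d_def)
  qed
qed

section \<open>Leavitt path algebras\<close>

locale leavitt = wf_digraph E for E :: "('v, 'e) pre_digraph" +
  fixes K :: "'k::field itself"
begin

abbreviation gens where "gens \<equiv> leavitt_gens E"
abbreviation rels :: "(('v, 'e) leavitt_gen free_monoid \<Rightarrow>\<^sub>0 'k) set" where
  "rels \<equiv> leavitt_relations E"

lemma vertex_gen [simp]: "Vertex v \<in> gens \<longleftrightarrow> v \<in> verts E"
  and edge_gen [simp]: "Edge e \<in> gens \<longleftrightarrow> e \<in> arcs E"
  and ghost_gen [simp]: "Ghost e \<in> gens \<longleftrightarrow> e \<in> arcs E"
  by (auto simp: leavitt_gens_def)

lemma leavitt_relations_closed: "rels \<subseteq> carrier (free_algebra gens)"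
proof -
  have sum: "(\<Sum>e\<in>S. f e) \<in> carrier (free_algebra gens)"
    if "\<And>e. e \<in> S \<Longrightarrow> f e \<in> carrier (free_algebra gens)" for S :: "'e set" and f :: "'e \<Rightarrow> _ \<Rightarrow>\<^sub>0 'k"
    using that by (induction S rule: infinite_finite_induct) (auto intro: free_algebra_closed)
  show ?thesis
    unfolding leavitt_relations_def Let_def free_gen_def
    by (auto simp: word_mult intro!: free_algebra_closed sum)
qed

sublocale P: presentation gens rels
  by unfold_locales (rule leavitt_relations_closed)

lemma leavitt_path_algebra_eq: "leavitt_path_algebra K E = P.L"
  by (simp add: leavitt_path_algebra_def)

section \<open>The relations as rewriting rules inside words\<close>

abbreviation wcls where "wcls u \<equiv> P.cls (word u)"

text \<open>The contexts may be empty, and then \<open>word []\<close> is 1, outside the free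
  algebra without unit; the ideal rules do not apply to it, hence the case distinctions.\<close>

lemma cls_context:
  assumes "P.cls f = P.cls g" "set u \<subseteq> gens" "set v \<subseteq> gens"
  shows "P.cls (word u * f * word v) = P.cls (word u * g * word v)"
proof -
  have "word u * h \<in> P.J" if "h \<in> P.J" for h
    using that assms(2) by (cases "u = []") (auto intro: P.J_mult_left)
  moreover have "h * word v \<in> P.J" if "h \<in> P.J" for h
    using that assms(3) by (cases "v = []") (auto intro: P.J_mult_right)
  ultimately have "word u * (f - g) * word v \<in> P.J"
    using assms(1) by (simp add: P.cls_eq_iff)
  then show ?thesis by (simp add: P.cls_eq_iff algebra_simps)
qed

lemma wcls_context:
  "wcls u = wcls v \<Longrightarrow> set a \<subseteq> gens \<Longrightarrow> set b \<subseteq> gens \<Longrightarrow> wcls (a @ u @ b) = wcls (a @ v @ b)"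
  using cls_context[of "word u" "word v" a b] by (simp add: word_mult)

lemma wcls_context_zero:
  "wcls u = P.cls 0 \<Longrightarrow> set a \<subseteq> gens \<Longrightarrow> set b \<subseteq> gens \<Longrightarrow> wcls (a @ u @ b) = P.cls 0"
  using cls_context[of "word u" 0 a b] by (simp add: word_mult)

lemma relation: "f \<in> rels \<Longrightarrow> f \<in> P.J"
  by (rule generated_ideal.incl)

lemma wcls_vertex_vertex:
  assumes "v \<in> verts E" "w \<in> verts E"
  shows "wcls [Vertex v, Vertex w] = (if v = w then wcls [Vertex v] else P.cls 0)"
proof -
  have "word [Vertex v, Vertex w] - (if v = w then word [Vertex v] else 0) \<in> rels"
    unfolding leavitt_relations_def Let_def free_gen_def
    by ((rule UnI1)+, rule CollectI, intro exI[of _ v] exI[of _ w])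
      (use assms in \<open>simp add: word_mult\<close>)
  then show ?thesis using relation by (auto simp: P.cls_eq_iff split: if_splits)
qed

lemma wcls_tail_edge:
  assumes "e \<in> arcs E"
  shows "wcls [Vertex (tail E e), Edge e] = wcls [Edge e]"
proof -
  have "word [Vertex (tail E e), Edge e] - word [Edge e] \<in> rels"
    unfolding leavitt_relations_def Let_def free_gen_def
    using assms by (force simp: word_mult)
  then show ?thesis using relation by (simp add: P.cls_eq_iff)
qed

lemma wcls_edge_head:
  assumes "e \<in> arcs E"
  shows "wcls [Edge e, Vertex (head E e)] = wcls [Edge e]"
proof -
  have "word [Edge e, Vertex (head E e)] - word [Edge e] \<in> rels"
    unfolding leavitt_relations_def Let_def free_gen_def
    using assms by (force simp: word_mult)
  then show ?thesis using relation by (simp add: P.cls_eq_iff)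
qed

lemma wcls_head_ghost:
  assumes "e \<in> arcs E"
  shows "wcls [Vertex (head E e), Ghost e] = wcls [Ghost e]"
proof -
  have "word [Vertex (head E e), Ghost e] - word [Ghost e] \<in> rels"
    unfolding leavitt_relations_def Let_def free_gen_def
    using assms by (force simp: word_mult)
  then show ?thesis using relation by (simp add: P.cls_eq_iff)
qed

lemma wcls_ghost_tail:
  assumes "e \<in> arcs E"
  shows "wcls [Ghost e, Vertex (tail E e)] = wcls [Ghost e]"
proof -
  have "word [Ghost e, Vertex (tail E e)] - word [Ghost e] \<in> rels"
    unfolding leavitt_relations_def Let_def free_gen_def
    using assms by (force simp: word_mult)
  then show ?thesis using relation by (simp add: P.cls_eq_iff)
qed

lemma wcls_ghost_edge:
  assumes "e \<in> arcs E" "f \<in> arcs E"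
  shows "wcls [Ghost e, Edge f] = (if e = f then wcls [Vertex (head E e)] else P.cls 0)"
proof -
  have "word [Ghost e, Edge f] - (if e = f then word [Vertex (head E e)] else 0) \<in> rels"
    unfolding leavitt_relations_def Let_def free_gen_def
    using assms by (force simp: word_mult)
  then show ?thesis using relation by (auto simp: P.cls_eq_iff split: if_splits)
qed

text \<open>With a single outgoing edge the sum in relation (iv) has one term.\<close>

lemma wcls_edge_ghost:
  assumes "e \<in> arcs E" "out_arcs E (tail E e) = {e}"
  shows "wcls [Edge e, Ghost e] = wcls [Vertex (tail E e)]"
proof -
  have "word [Vertex (tail E e)] - (\<Sum>f\<in>out_arcs E (tail E e). word [Edge f] * word [Ghost f]) \<in> rels"
    unfolding leavitt_relations_def Let_def free_gen_def
    using assms by (intro UnI2) (auto simp del: in_out_arcs_conv intro!: exI[of _ "tail E e"])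
  then have "word [Vertex (tail E e)] - word [Edge e, Ghost e] \<in> P.J"
    using relation by (simp add: assms(2) word_mult)
  then show ?thesis by (simp flip: P.cls_eq_iff)
qed

text \<open>Splitting the adjacent end vertices off the two edges puts two orthogonal idempotents
  side by side. The next three lemmas use the same device.\<close>

lemma wcls_edge_edge:
  assumes "e \<in> arcs E" "f \<in> arcs E" "head E e \<noteq> tail E f"
  shows "wcls [Edge e, Edge f] = P.cls 0"
proof -
  have "wcls [Edge e, Edge f] = wcls [Edge e, Vertex (head E e), Edge f]"
    using wcls_context[OF wcls_edge_head[OF assms(1)], of "[]" "[Edge f]"] assms by simp
  also have "\<dots> = wcls [Edge e, Vertex (head E e), Vertex (tail E f), Edge f]"
    using wcls_context[OF wcls_tail_edge[OF assms(2)], of "[Edge e, Vertex (head E e)]" "[]"] assms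
    by simp
  also have "\<dots> = P.cls 0"
    using wcls_context_zero[of "[Vertex (head E e), Vertex (tail E f)]" "[Edge e]" "[Edge f]"] assms
    by (simp add: wcls_vertex_vertex)
  finally show ?thesis .
qed

lemma wcls_vertex_edge:
  assumes "v \<in> verts E" "e \<in> arcs E" "v \<noteq> tail E e"
  shows "wcls [Vertex v, Edge e] = P.cls 0"
proof -
  have "wcls [Vertex v, Edge e] = wcls [Vertex v, Vertex (tail E e), Edge e]"
    using wcls_context[OF wcls_tail_edge[OF assms(2)], of "[Vertex v]" "[]"] assms by simp
  also have "\<dots> = P.cls 0"
    using wcls_context_zero[of "[Vertex v, Vertex (tail E e)]" "[]" "[Edge e]"] assms
    by (simp add: wcls_vertex_vertex)
  finally show ?thesis .
qed

lemma wcls_edge_vertex: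
  assumes "v \<in> verts E" "e \<in> arcs E" "v \<noteq> head E e"
  shows "wcls [Edge e, Vertex v] = P.cls 0"
proof -
  have "wcls [Edge e, Vertex v] = wcls [Edge e, Vertex (head E e), Vertex v]"
    using wcls_context[OF wcls_edge_head[OF assms(2)], of "[]" "[Vertex v]"] assms by simp
  also have "\<dots> = P.cls 0"
    using wcls_context_zero[of "[Vertex (head E e), Vertex v]" "[Edge e]" "[]"] assms
    by (simp add: wcls_vertex_vertex)
  finally show ?thesis .
qed

lemma wcls_ghost_vertex:
  assumes "v \<in> verts E" "e \<in> arcs E" "v \<noteq> tail E e"
  shows "wcls [Ghost e, Vertex v] = P.cls 0"
proof -
  have "wcls [Ghost e, Vertex v] = wcls [Ghost e, Vertex (tail E e), Vertex v]"
    using wcls_context[OF wcls_ghost_tail[OF assms(2)], of "[]" "[Vertex v]"] assms by simp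
  also have "\<dots> = P.cls 0"
    using wcls_context_zero[of "[Vertex (tail E e), Vertex v]" "[Ghost e]" "[]"] assms
    by (simp add: wcls_vertex_vertex)
  finally show ?thesis .
qed

subsection \<open>Normal forms\<close>

declare awalk_append_iff [simp del]

lemma awalk_snoc_iff: "awalk u (p @ [e]) v \<longleftrightarrow> e \<in> arcs E \<and> v = head E e \<and> awalk u p (tail E e)"
  by (induction p arbitrary: u) (auto simp: awalk_Cons_iff awalk_Nil_iff)

text \<open>The middle vertex keeps the word nonempty; up to the relations it is the monomial
  \<open>\<alpha> \<beta>\<^sup>*\<close>.\<close>
definition nf :: "'e list \<times> 'v \<times> 'e list \<Rightarrow> ('v, 'e) leavitt_gen list" where
  "nf = (\<lambda>(\<alpha>, v, \<beta>). map Edge \<alpha> @ Vertex v # map Ghost (rev \<beta>))"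

definition edges_in :: "('v, 'e) leavitt_gen set \<Rightarrow> 'e set" where
  "edges_in F = {e. Edge e \<in> F \<or> Ghost e \<in> F}"

text \<open>Reductions create end vertices of the edges involved that need not be letters of
  \<open>F\<close>; counting them here keeps the set finite and closed under rewriting.\<close>

definition verts_in :: "('v, 'e) leavitt_gen set \<Rightarrow> 'v set" where
  "verts_in F = {v. Vertex v \<in> F} \<union> tail E ` edges_in F \<union> head E ` edges_in F"

definition NF :: "('v, 'e) leavitt_gen set \<Rightarrow> nat \<Rightarrow> ('e list \<times> 'v \<times> 'e list) set" where
  "NF F n = {(\<alpha>, v, \<beta>). (\<exists>x. awalk x \<alpha> v) \<and> (\<exists>y. awalk y \<beta> v) \<and>
     set \<alpha> \<subseteq> edges_in F \<and> set \<beta> \<subseteq> edges_in F \<and> v \<in> verts_in F \<and> length \<alpha> + length \<beta> \<le> n}"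

lemma finite_edges_in: "finite F \<Longrightarrow> finite (edges_in F)"
proof -
  assume "finite F"
  then have "finite ((\<lambda>x. case x of Edge e \<Rightarrow> e | Ghost e \<Rightarrow> e | Vertex v \<Rightarrow> undefined) ` F)" by simp
  moreover have "edges_in F \<subseteq> (\<lambda>x. case x of Edge e \<Rightarrow> e | Ghost e \<Rightarrow> e | Vertex v \<Rightarrow> undefined) ` F"
    unfolding edges_in_def by force
  ultimately show ?thesis by (rule rev_finite_subset)
qed

lemma finite_verts_in:
  assumes "finite F"
  shows "finite (verts_in F)"
proof -
  have "{v. Vertex v \<in> F} \<subseteq> (\<lambda>x. case x of Vertex v \<Rightarrow> v) ` F" by force
  then show ?thesis
    using assms finite_edges_in[OF assms] finite_subset unfolding verts_in_def by blast
qed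

lemma edges_in_subset: "F \<subseteq> gens \<Longrightarrow> edges_in F \<subseteq> arcs E"
  unfolding edges_in_def by auto

lemma verts_in_subset: "F \<subseteq> gens \<Longrightarrow> verts_in F \<subseteq> verts E"
  unfolding verts_in_def using edges_in_subset[of F] by auto

lemma nf_gens:
  assumes "F \<subseteq> gens" "(\<alpha>, v, \<beta>) \<in> NF F n"
  shows "set (nf (\<alpha>, v, \<beta>)) \<subseteq> gens"
  using assms(2) edges_in_subset[OF assms(1)] verts_in_subset[OF assms(1)]
  by (auto simp: NF_def nf_def)

lemma wcls_nf_closed: "F \<subseteq> gens \<Longrightarrow> t \<in> NF F n \<Longrightarrow> wcls (nf t) \<in> carrier P.L"
  using nf_gens[of F "fst t" "fst (snd t)" "snd (snd t)" n]
  by (auto simp: nf_def split: prod.splits)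

text \<open>Left multiplication by one letter suffices, as words are built from the right. A letter
  that does not kill the monomial is absorbed, extends \<alpha>, cancels the first edge of \<alpha>,
  or, being a ghost that meets an empty \<alpha>, extends \<beta> at its end.\<close>

lemma nf_Cons:
  assumes F: "F \<subseteq> gens" and a: "a \<in> F" and t: "(\<alpha>, v, \<beta>) \<in> NF F n"
  shows "wcls (a # nf (\<alpha>, v, \<beta>)) = P.cls 0 \<or> (\<exists>t\<in>NF F (Suc n). wcls (a # nf (\<alpha>, v, \<beta>)) = wcls (nf t))"
proof -
  obtain x y where walks: "awalk x \<alpha> v" "awalk y \<beta> v" using t by (auto simp: NF_def)
  have sets: "set \<alpha> \<subseteq> edges_in F" "set \<beta> \<subseteq> edges_in F" "v \<in> verts_in F"
    "length \<alpha> + length \<beta> \<le> n" using t by (auto simp: NF_def)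
  have v: "v \<in> verts E" using verts_in_subset[OF F] sets(3) by blast
  have gh: "set (map Ghost (rev \<beta>)) \<subseteq> gens" using edges_in_subset[OF F] sets(2) by auto
  have tSuc: "(\<alpha>, v, \<beta>) \<in> NF F (Suc n)" using t by (auto simp: NF_def)
  have nil: "nf ([], v, \<beta>) = Vertex v # map Ghost (rev \<beta>)" by (simp add: nf_def)
  have cons: "nf (f # \<alpha>', v, \<beta>) = Edge f # nf (\<alpha>', v, \<beta>)" for f \<alpha>' by (simp add: nf_def)
  \<comment> \<open>Needed twice: for a vertex letter, and for the vertex left over when a ghost
    cancels the first edge. Hence \<alpha> and \<open>n\<close> are generalised.\<close>
  have vertex: "wcls (Vertex u # nf (\<alpha>, v, \<beta>)) = P.cls 0 \<or> wcls (Vertex u # nf (\<alpha>, v, \<beta>)) = wcls (nf (\<alpha>, v, \<beta>))"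
    if t: "(\<alpha>, v, \<beta>) \<in> NF F n" and u: "u \<in> verts E" for u \<alpha> n
  proof (cases \<alpha>)
    case Nil
    then show ?thesis
      using wcls_context_zero[of "[Vertex u, Vertex v]" "[]" "map Ghost (rev \<beta>)"]
        wcls_context[of "[Vertex u, Vertex v]" "[Vertex v]" "[]" "map Ghost (rev \<beta>)"] u v gh
      by (cases "u = v") (auto simp: nil wcls_vertex_vertex)
  next
    case (Cons f \<alpha>')
    then have f: "f \<in> arcs E" "set (nf (\<alpha>', v, \<beta>)) \<subseteq> gens"
      using nf_gens[OF F t] by (auto simp: cons)
    then show ?thesis
      using wcls_context_zero[of "[Vertex u, Edge f]" "[]" "nf (\<alpha>', v, \<beta>)"]
        wcls_context[of "[Vertex u, Edge f]" "[Edge f]" "[]" "nf (\<alpha>', v, \<beta>)"] u Cons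
      by (cases "u = tail E f") (auto simp: cons wcls_tail_edge wcls_vertex_edge)
  qed
  show ?thesis
  proof (cases a)
    case (Vertex u)
    then show ?thesis using vertex[OF t, of u] tSuc a F by (auto dest: subsetD)
  next
    case (Edge e)
    have e: "e \<in> arcs E" "e \<in> edges_in F" using a F Edge by (auto simp: edges_in_def dest: subsetD)
    show ?thesis
    proof (cases \<alpha>)
      case Nil
      show ?thesis
      proof (cases "v = head E e")
        case True
        have "a # nf (\<alpha>, v, \<beta>) = nf ([e], v, \<beta>)" by (simp add: Edge Nil nf_def)
        moreover have "([e], v, \<beta>) \<in> NF F (Suc n)"
          using walks sets e Nil True by (auto simp: NF_def awalk_Cons_iff awalk_Nil_iff)
        ultimately show ?thesis by metis
      next
        case False
        then show ?thesis
          using wcls_context_zero[of "[Edge e, Vertex v]" "[]" "map Ghost (rev \<beta>)"] e v gh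
          by (simp add: Nil nil Edge wcls_edge_vertex)
      qed
    next
      case (Cons f \<alpha>')
      then have f: "f \<in> arcs E" "set (nf (\<alpha>', v, \<beta>)) \<subseteq> gens"
        using nf_gens[OF F t] by (auto simp: cons)
      show ?thesis
      proof (cases "head E e = tail E f")
        case True
        have "a # nf (\<alpha>, v, \<beta>) = nf (e # \<alpha>, v, \<beta>)" by (simp add: Edge nf_def)
        moreover have "(e # \<alpha>, v, \<beta>) \<in> NF F (Suc n)"
          using walks sets e Cons True by (auto simp: NF_def awalk_Cons_iff)
        ultimately show ?thesis by metis
      next
        case False
        then show ?thesis
          using wcls_context_zero[of "[Edge e, Edge f]" "[]" "nf (\<alpha>', v, \<beta>)"] e f
          by (simp add: Cons cons Edge wcls_edge_edge)
      qed
    qed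
  next
    case (Ghost e)
    have e: "e \<in> arcs E" "e \<in> edges_in F" using a F Ghost by (auto simp: edges_in_def dest: subsetD)
    show ?thesis
    proof (cases \<alpha>)
      case Nil
      show ?thesis
      proof (cases "v = tail E e")
        case True
        have "wcls (a # nf (\<alpha>, v, \<beta>)) = wcls (Ghost e # map Ghost (rev \<beta>))"
          using wcls_context[OF wcls_ghost_tail[OF e(1)], of "[]" "map Ghost (rev \<beta>)"] gh
          by (simp add: Nil nf_def Ghost True)
        also have "\<dots> = wcls (nf ([], head E e, \<beta> @ [e]))"
          using wcls_context[OF wcls_head_ghost[OF e(1)], of "[]" "map Ghost (rev \<beta>)"] gh
          by (simp add: nf_def)
        finally have "wcls (a # nf (\<alpha>, v, \<beta>)) = wcls (nf ([], head E e, \<beta> @ [e]))" .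
        moreover have "([], head E e, \<beta> @ [e]) \<in> NF F (Suc n)"
          using walks sets e Nil True
          by (auto simp: NF_def awalk_snoc_iff awalk_Nil_iff verts_in_def)
        ultimately show ?thesis by metis
      next
        case False
        then show ?thesis
          using wcls_context_zero[of "[Ghost e, Vertex v]" "[]" "map Ghost (rev \<beta>)"] e v gh
          by (simp add: Nil nil Ghost wcls_ghost_vertex)
      qed
    next
      case (Cons f \<alpha>')
      then have f: "f \<in> arcs E" "set (nf (\<alpha>', v, \<beta>)) \<subseteq> gens"
        using nf_gens[OF F t] by (auto simp: cons)
      have t': "(\<alpha>', v, \<beta>) \<in> NF F n"
        using walks sets Cons by (auto simp: NF_def awalk_Cons_iff)
      then have t'': "(\<alpha>', v, \<beta>) \<in> NF F (Suc n)" by (auto simp: NF_def)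
      show ?thesis
      proof (cases "e = f")
        case True
        have "wcls (a # nf (\<alpha>, v, \<beta>)) = wcls (Vertex (head E e) # nf (\<alpha>', v, \<beta>))"
          using wcls_context[of "[Ghost e, Edge f]" "[Vertex (head E e)]" "[]" "nf (\<alpha>', v, \<beta>)"] e f True
          by (simp add: Cons cons Ghost wcls_ghost_edge)
        then show ?thesis using vertex[OF t', of "head E e"] t'' e by auto
      next
        case False
        then show ?thesis
          using wcls_context_zero[of "[Ghost e, Edge f]" "[]" "nf (\<alpha>', v, \<beta>)"] e f
          by (simp add: Cons cons Ghost wcls_ghost_edge)
      qed
    qed
  qed
qed

lemma wcls_normal_form:
  assumes F: "F \<subseteq> gens" and "u \<noteq> []" "set u \<subseteq> F"
  shows "wcls u = P.cls 0 \<or> (\<exists>t\<in>NF F (length u). wcls u = wcls (nf t))"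
  using assms(2,3)
proof (induction u rule: list_nonempty_induct)
  case (single a)
  have a: "a \<in> F" "a \<in> gens" using single F by auto
  show ?case
  proof (cases a)
    case (Vertex v)
    then have "([], v, []) \<in> NF F (Suc 0)" "nf ([], v, []) = [a]"
      using a by (auto simp: NF_def nf_def awalk_Nil_iff verts_in_def)
    then show ?thesis by force
  next
    case (Edge e)
    then have "([e], head E e, []) \<in> NF F (Suc 0)" "nf ([e], head E e, []) = [a, Vertex (head E e)]"
      using a by (auto simp: NF_def nf_def awalk_Nil_iff awalk_Cons_iff verts_in_def edges_in_def)
    then show ?thesis using wcls_edge_head[of e] a Edge by force
  next
    case (Ghost e)
    then have "([], head E e, [e]) \<in> NF F (Suc 0)" "nf ([], head E e, [e]) = [Vertex (head E e), a]"
      using a by (auto simp: NF_def nf_def awalk_Nil_iff awalk_Cons_iff verts_in_def edges_in_def)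
    then show ?thesis using wcls_head_ghost[of e] a Ghost by force
  qed
next
  case (cons a u)
  then have a: "a \<in> F" "set [a] \<subseteq> gens" using F by auto
  from cons have "wcls u = P.cls 0 \<or> (\<exists>t\<in>NF F (length u). wcls u = wcls (nf t))" by simp
  then show ?case
  proof
    assume "wcls u = P.cls 0"
    then show ?thesis using wcls_context_zero[of u "[a]" "[]"] a by simp
  next
    assume "\<exists>t\<in>NF F (length u). wcls u = wcls (nf t)"
    then obtain \<alpha> v \<beta> where t: "(\<alpha>, v, \<beta>) \<in> NF F (length u)" "wcls u = wcls (nf (\<alpha>, v, \<beta>))" by auto
    have "wcls (a # u) = wcls (a # nf (\<alpha>, v, \<beta>))" using wcls_context[OF t(2), of "[a]" "[]"] a by simp
    then show ?thesis using nf_Cons[OF F a(1) t(1)] by simp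
  qed
qed

lemma words_subset_lin_span:
  assumes "F \<subseteq> gens" "(\<lambda>t. wcls (nf t)) ` NF F n \<subseteq> lin_span P.L D"
  shows "P.words F n \<subseteq> lin_span P.L D"
proof
  fix x assume "x \<in> P.words F n"
  then obtain u where u: "x = wcls u" "u \<noteq> []" "set u \<subseteq> F" "length u \<le> n"
    unfolding P.words_def by blast
  have "NF F (length u) \<subseteq> NF F n" using u(4) by (auto simp: NF_def)
  then show "x \<in> lin_span P.L D"
    using wcls_normal_form[OF assms(1) u(2,3)] assms(2) u(1)
    by (auto simp flip: P.L_zero intro: lin_span.zero)
qed

section \<open>Upper bounds from normal forms\<close>

lemma awalk_append:
  "awalk u (p @ q) v \<Longrightarrow> \<exists>w. awalk u p w \<and> awalk w q v"
  by (induction p arbitrary: u) (auto simp: awalk_Cons_iff awalk_Nil_iff intro: awalk_hd_in_verts)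

text \<open>A repeated edge cuts out a closed path, so every path is a list without repetition. Over
  a finite set of edges this leaves finitely many normal forms, whatever the length.\<close>

lemma GKdim_acyclic:
  assumes acyclic: "\<And>x p. awalk x p x \<Longrightarrow> p = []"
  shows "GKdim (leavitt_path_algebra K E) \<le> 0"
proof -
  have distinct: "distinct p" if walk: "awalk x p y" for x p y
  proof (rule ccontr)
    assume "\<not> distinct p"
    then obtain q r s e where p: "p = q @ [e] @ r @ [e] @ s"
      using not_distinct_decomp by blast
    then obtain w where "awalk w ([e] @ r @ [e] @ s) y" using walk awalk_append by blast
    then have "awalk (head E e) (r @ [e] @ s) y" by (simp add: awalk_Cons_iff)
    then obtain z where "awalk (head E e) r z" "awalk z ([e] @ s) y" using awalk_append by blast
    \<comment> \<open>After the first occurrence of \<open>e\<close> the path follows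
      \<open>r\<close> up to the second one; completing \<open>r\<close> by \<open>e\<close> closes
      it at the head of \<open>e\<close>.\<close>
    then have "awalk (head E e) (r @ [e]) (head E e)"
      by (auto simp: awalk_snoc_iff awalk_Cons_iff)
    then show False using acyclic by blast
  qed
  have "GKdim P.L \<le> ereal (real 0)"
  proof (rule P.GKdim_upper_words)
    fix F assume F: "finite F" "F \<subseteq> gens"
    let ?W = "{p. set p \<subseteq> edges_in F \<and> distinct p}"
    have "finite ?W" using finite_edges_in[OF F(1)]
      by (rule finite_subset_distinct)
    then have fin: "finite (?W \<times> verts_in F \<times> ?W)" using finite_verts_in[OF F(1)] by simp
    let ?D = "\<Union>n. (\<lambda>t. wcls (nf t)) ` NF F n"
    have "NF F n \<subseteq> ?W \<times> verts_in F \<times> ?W" for n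
      using distinct by (auto simp: NF_def)
    then have "finite (\<Union>n. NF F n)" using fin by (meson UN_least finite_subset)
    then have "finite ?D" by (metis finite_imageI image_UN)
    moreover have "?D \<subseteq> carrier P.L" using wcls_nf_closed[OF F(2)] by blast
    moreover have "P.words F n \<subseteq> lin_span P.L ?D" for n
      using F(2) by (intro words_subset_lin_span) (auto intro: lin_span.incl)
    ultimately show "\<exists>c. \<forall>n>0. \<exists>D. finite D \<and> D \<subseteq> carrier P.L \<and> card D \<le> c * n ^ 0 \<and>
        P.words F n \<subseteq> lin_span P.L D"
      by (intro exI[of _ "card ?D"] allI impI exI[of _ ?D]) simp
  qed
  then show ?thesis by (simp add: leavitt_path_algebra_eq zero_ereal_def one_ereal_def)
qed

text \<open>A common last edge of \<alpha> and \<beta> meets its own ghost in the middle of the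
  monomial, where relation (iv) removes the pair.\<close>

lemma nf_strip:
  assumes "F \<subseteq> gens" "(\<alpha> @ [e], v, \<beta> @ [e]) \<in> NF F n" "out_arcs E (tail E e) = {e}"
  shows "wcls (nf (\<alpha> @ [e], v, \<beta> @ [e])) = wcls (nf (\<alpha>, tail E e, \<beta>))"
    "(\<alpha>, tail E e, \<beta>) \<in> NF F n"
proof -
  have e: "e \<in> arcs E" "v = head E e" "e \<in> edges_in F"
    using assms(2) by (auto simp: NF_def awalk_snoc_iff)
  have gens: "set (map Edge \<alpha>) \<subseteq> gens" "set (Ghost e # map Ghost (rev \<beta>)) \<subseteq> gens"
    using nf_gens[OF assms(1,2)] by (auto simp: nf_def)
  have "wcls (nf (\<alpha> @ [e], v, \<beta> @ [e])) = wcls (map Edge \<alpha> @ [Edge e] @ Ghost e # map Ghost (rev \<beta>))"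
    using wcls_context[OF wcls_edge_head[OF e(1)] gens] by (simp add: nf_def e(2))
  also have "\<dots> = wcls (nf (\<alpha>, tail E e, \<beta>))"
    using wcls_context[OF wcls_edge_ghost[OF e(1) assms(3)] gens(1), of "map Ghost (rev \<beta>)"] gens
    by (simp add: nf_def)
  finally show "wcls (nf (\<alpha> @ [e], v, \<beta> @ [e])) = wcls (nf (\<alpha>, tail E e, \<beta>))" .
  show "(\<alpha>, tail E e, \<beta>) \<in> NF F n"
    using assms(2) e by (auto simp: NF_def awalk_snoc_iff verts_in_def)
qed

lemma GKdim_functional_graph:
  assumes out: "\<And>e. e \<in> arcs E \<Longrightarrow> out_arcs E (tail E e) = {e}"
    and inj: "inj_on (head E) (arcs E)"
  shows "GKdim (leavitt_path_algebra K E) \<le> 1"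
proof -
  \<comment> \<open>Paths are compared from their ends: injectivity of \<open>head\<close> leaves at
    most one edge into each vertex, so the end and the length determine the path.\<close>
  have unique: "\<alpha> = \<beta>" if "awalk x \<alpha> v" "awalk y \<beta> v" "length \<alpha> = length \<beta>" for x y v \<alpha> \<beta>
    using that(3,1,2)
  proof (induction \<alpha> arbitrary: \<beta> v rule: rev_induct)
    case (snoc e \<alpha>)
    then obtain f \<beta>' where \<beta>: "\<beta> = \<beta>' @ [f]" by (cases \<beta> rule: rev_cases) auto
    then have "e = f" using snoc.prems inj by (auto simp: awalk_snoc_iff dest: inj_onD)
    then show ?case using snoc \<beta> by (auto simp: awalk_snoc_iff)
  qed auto
  \<comment> \<open>If both paths are nonempty, their last edges share the head \<open>v\<close>,
    hence coincide and can be stripped; this is repeated until one side is empty.\<close>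
  have one_sided: "\<exists>t\<in>NF F n. wcls (nf (\<alpha>, v, \<beta>)) = wcls (nf t) \<and> (fst t = [] \<or> snd (snd t) = [])"
    if "F \<subseteq> gens" "(\<alpha>, v, \<beta>) \<in> NF F n" for F n \<alpha> v \<beta>
    using that(2)
  proof (induction \<alpha> arbitrary: v \<beta> rule: rev_induct)
    case Nil
    then show ?case by force
  next
    case (snoc e \<alpha>)
    show ?case
    proof (cases \<beta> rule: rev_cases)
      case Nil
      then show ?thesis using snoc.prems by force
    next
      case (snoc \<beta>' f)
      have "f = e" "e \<in> arcs E"
        using snoc.prems inj unfolding snoc by (auto simp: NF_def awalk_snoc_iff dest: inj_onD)
      then show ?thesis
        using snoc.IH nf_strip[OF that(1) _ out, of \<alpha> e v \<beta>' n] snoc.prems snoc by metis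
    qed
  qed
  have "GKdim P.L \<le> ereal (real 1)"
  proof (rule P.GKdim_upper_words)
    fix F assume F: "finite F" "F \<subseteq> gens"
    define W where "W n = {(v, \<alpha>). v \<in> verts_in F \<and> length \<alpha> \<le> n \<and> (\<exists>x. awalk x \<alpha> v)}" for n
    have W: "finite (W n)" "card (W n) \<le> card (verts_in F) * Suc n" for n
    proof -
      have inj: "inj_on (\<lambda>(v, \<alpha>). (v, length \<alpha>)) (W n)"
        by (rule inj_onI) (auto simp: W_def intro: unique)
      have sub: "(\<lambda>(v, \<alpha>). (v, length \<alpha>)) ` W n \<subseteq> verts_in F \<times> {..n}" by (auto simp: W_def)
      have fin: "finite (verts_in F \<times> {..n})" using finite_verts_in[OF F(1)] by simp
      show "finite (W n)" using inj sub fin by (rule inj_on_finite)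
      show "card (W n) \<le> card (verts_in F) * Suc n"
        using card_inj_on_le[OF inj sub fin] by (simp add: card_cartesian_product)
    qed
    \<comment> \<open>The factor 4 is 2 for the two kinds of one-sided monomials times 2 from
      \<open>Suc n \<le> 2 * n\<close>.\<close>
    have "\<exists>D. finite D \<and> D \<subseteq> carrier P.L \<and> card D \<le> (4 * card (verts_in F)) * n ^ 1 \<and>
        P.words F n \<subseteq> lin_span P.L D" if n: "n > 0" for n
    proof -
      let ?T = "(\<lambda>(v, \<alpha>). (\<alpha>, v, [])) ` W n \<union> (\<lambda>(v, \<beta>). ([], v, \<beta>)) ` W n"
      let ?D = "(\<lambda>t. wcls (nf t)) ` (?T \<inter> NF F n)"
      have finT: "finite ?T" using W(1) by simp
      have "card ?D \<le> card (?T \<inter> NF F n)" using finT by (intro card_image_le) simp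
      also have "\<dots> \<le> card ?T" using finT by (intro card_mono) auto
      also have "\<dots> \<le> card (W n) + card (W n)"
        by (rule order_trans[OF card_Un_le]) (intro add_mono card_image_le W)
      also have "\<dots> \<le> 2 * (card (verts_in F) * Suc n)" using W(2)[of n] by simp
      also have "\<dots> \<le> (4 * card (verts_in F)) * n ^ 1" using n by (simp add: mult_le_mono)
      finally have "card ?D \<le> (4 * card (verts_in F)) * n ^ 1" .
      moreover have "P.words F n \<subseteq> lin_span P.L ?D"
      proof (rule words_subset_lin_span[OF F(2)], rule image_subsetI)
        fix t assume "t \<in> NF F n"
        then obtain t' where t': "t' \<in> NF F n" "wcls (nf t) = wcls (nf t')"
          "fst t' = [] \<or> snd (snd t') = []" using one_sided[OF F(2)] by (cases t) blast
        then have "t' \<in> ?T" by (cases t') (force simp: NF_def W_def)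
        then show "wcls (nf t) \<in> lin_span P.L ?D"
          unfolding t'(2) using t'(1) by (intro lin_span.incl imageI IntI)
      qed
      moreover have "?D \<subseteq> carrier P.L" using wcls_nf_closed[OF F(2)] by blast
      moreover have "finite ?D" using finT by simp
      ultimately show ?thesis by blast
    qed
    then show "\<exists>c. \<forall>n>0. \<exists>D. finite D \<and> D \<subseteq> carrier P.L \<and> card D \<le> c * n ^ 1 \<and>
        P.words F n \<subseteq> lin_span P.L D" by blast
  qed
  then show ?thesis by (simp add: leavitt_path_algebra_eq zero_ereal_def one_ereal_def)
qed

end

section \<open>Hopf graphs\<close>

locale hopf = group G for G :: "('g, 'm) monoid_scheme" (structure) +
  fixes r :: "'g set \<Rightarrow> nat" and K :: "'k::field itself"
begin

text \<open>The same set of labels serves every vertex: an edge leaving \<open>x\<close> is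
  \<open>x\<close> together with a label, and it acts by right multiplication with the group
  component.\<close>

definition labels :: "('g \<times> nat) set" where
  "labels = {(c, i). \<exists>C\<in>conj_classes G. c \<in> C \<and> i < r C}"

lemma conj_classes_closed: "C \<in> conj_classes G \<Longrightarrow> C \<subseteq> carrier G"
  by (auto simp: conj_classes_def)

lemma labels_closed: "(c, i) \<in> labels \<Longrightarrow> c \<in> carrier G"
  using conj_classes_closed by (auto simp: labels_def)

abbreviation "\<Gamma> \<equiv> hopf_graph G r"

lemma hopf_graph_simps [simp]:
  "verts \<Gamma> = carrier G" "(x, c, i) \<in> arcs \<Gamma> \<longleftrightarrow> x \<in> carrier G \<and> (c, i) \<in> labels"
  "tail \<Gamma> (x, c, i) = x" "head \<Gamma> (x, c, i) = x \<otimes> c"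
  by (auto simp: hopf_graph_def labels_def)

sublocale leavitt \<Gamma> K
  by unfold_locales (auto simp: hopf_graph_def conj_classes_def)

section \<open>Paths as label words, and closed paths as products equal to 1\<close>

fun lpath :: "'g \<Rightarrow> ('g \<times> nat) list \<Rightarrow> ('g \<times> 'g \<times> nat) list" where
  "lpath x [] = []"
| "lpath x ((c, i) # ts) = (x, c, i) # lpath (x \<otimes> c) ts"

fun lprod :: "('g \<times> nat) list \<Rightarrow> 'g" where
  "lprod [] = \<one>"
| "lprod ((c, i) # ts) = c \<otimes> lprod ts"

lemma fst_labels [simp]: "t \<in> labels \<Longrightarrow> fst t \<in> carrier G"
  using labels_closed by (cases t) auto

lemma lprod_closed [simp]: "set ts \<subseteq> labels \<Longrightarrow> lprod ts \<in> carrier G"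
  by (induction ts rule: lprod.induct) (auto simp: labels_closed)

lemma lprod_append:
  "set ts \<subseteq> labels \<Longrightarrow> set us \<subseteq> labels \<Longrightarrow> lprod (ts @ us) = lprod ts \<otimes> lprod us"
  by (induction ts rule: lprod.induct) (auto simp: m_assoc labels_closed)

lemma lpath_append:
  "x \<in> carrier G \<Longrightarrow> set ts \<subseteq> labels \<Longrightarrow> lpath x (ts @ us) = lpath x ts @ lpath (x \<otimes> lprod ts) us"
  by (induction x ts rule: lpath.induct) (auto simp: m_assoc labels_closed)

lemma lpath_arcs: "x \<in> carrier G \<Longrightarrow> set ts \<subseteq> labels \<Longrightarrow> set (lpath x ts) \<subseteq> arcs \<Gamma>"
proof (induction x ts rule: lpath.induct)
  case (2 x c i ts)
  then show ?case using labels_closed[of c i] by simp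
qed simp

lemma length_lpath [simp]: "length (lpath x ts) = length ts"
  by (induction x ts rule: lpath.induct) auto

lemma map_snd_lpath: "map snd (lpath x ts) = ts"
  by (induction x ts rule: lpath.induct) auto

text \<open>A path is its first vertex with a label word, and right multiplication by the product
  gives its end. Whether it is closed thus depends on the word only.\<close>

lemma awalk_imp_lpath:
  "awalk x p y \<Longrightarrow> \<exists>ts. set ts \<subseteq> labels \<and> p = lpath x ts \<and> y = x \<otimes> lprod ts"
proof (induction p arbitrary: x)
  case Nil
  then show ?case by (auto simp: awalk_Nil_iff intro!: exI[of _ "[]"])
next
  case (Cons e p)
  obtain z c i where e: "e = (z, c, i)" by (cases e)
  with Cons.prems have x: "x \<in> carrier G" "z = x" "(c, i) \<in> labels" "awalk (x \<otimes> c) p y"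
    by (auto simp: awalk_Cons_iff)
  then obtain ts where "set ts \<subseteq> labels" "p = lpath (x \<otimes> c) ts" "y = (x \<otimes> c) \<otimes> lprod ts"
    using Cons.IH by blast
  then show ?case using x e by (intro exI[of _ "(c, i) # ts"]) (auto simp: m_assoc labels_closed)
qed

lemma ramification_semigroup_eq:
  "ramification_semigroup G r = {lprod ts | ts. ts \<noteq> [] \<and> set ts \<subseteq> labels}"
proof (intro equalityI subsetI)
  fix x assume "x \<in> ramification_semigroup G r"
  then have "x \<in> generated_subsemigroup G (\<Union> (ramification_support G r))"
    by (simp add: ramification_semigroup_def)
  then show "x \<in> {lprod ts | ts. ts \<noteq> [] \<and> set ts \<subseteq> labels}"
  proof (induction rule: generated_subsemigroup.induct)
    case (incl x)
    \<comment> \<open>Index 0 is available because the class of \<open>x\<close> has positive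
      ramification.\<close>
    then have "(x, 0) \<in> labels" by (auto simp: ramification_support_def labels_def)
    then show ?case by (intro CollectI exI[of _ "[(x, 0)]"]) (auto simp: labels_closed)
  next
    case (mult x y)
    then obtain ts us where "x = lprod ts" "y = lprod us" "ts \<noteq> []" "set ts \<subseteq> labels" "set us \<subseteq> labels"
      by blast
    then show ?case by (intro CollectI exI[of _ "ts @ us"]) (auto simp: lprod_append)
  qed
next
  have "lprod ts \<in> generated_subsemigroup G (\<Union> (ramification_support G r))"
    if "ts \<noteq> []" "set ts \<subseteq> labels" for ts
    using that
  proof (induction ts rule: list_nonempty_induct)
    case (single t)
    obtain c i where t: "t = (c, i)" by (cases t)
    then have "c \<in> \<Union> (ramification_support G r)" "c \<in> carrier G"
      using single labels_closed[of c i] by (auto simp: labels_def ramification_support_def)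
    then show ?case by (simp add: t generated_subsemigroup.incl)
  next
    case (cons t ts)
    obtain c i where t: "t = (c, i)" by (cases t)
    then have "c \<in> \<Union> (ramification_support G r)"
      using cons by (auto simp: labels_def ramification_support_def)
    then show ?case using cons t by (auto intro: generated_subsemigroup.intros)
  qed
  then show "x \<in> ramification_semigroup G r"
    if "x \<in> {lprod ts | ts. ts \<noteq> [] \<and> set ts \<subseteq> labels}" for x
    using that by (auto simp: ramification_semigroup_def)
qed

text \<open>Translates the condition on the semigroup into the existence of a closed path of
  positive length.\<close>

lemma submonoid_iff:
  "submonoid (ramification_semigroup G r) G \<longleftrightarrow> (\<exists>ts. ts \<noteq> [] \<and> set ts \<subseteq> labels \<and> lprod ts = \<one>)"
proof
  assume "submonoid (ramification_semigroup G r) G"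
  then have "\<one> \<in> ramification_semigroup G r" by (rule submonoid.one_closed)
  then show "\<exists>ts. ts \<noteq> [] \<and> set ts \<subseteq> labels \<and> lprod ts = \<one>"
    by (auto simp: ramification_semigroup_eq)
next
  assume one: "\<exists>ts. ts \<noteq> [] \<and> set ts \<subseteq> labels \<and> lprod ts = \<one>"
  show "submonoid (ramification_semigroup G r) G"
  proof
    show "ramification_semigroup G r \<subseteq> carrier G"
      by (auto simp: ramification_semigroup_eq)
    show "\<one> \<in> ramification_semigroup G r"
      using one unfolding ramification_semigroup_eq by force
    fix x y assume "x \<in> ramification_semigroup G r" "y \<in> ramification_semigroup G r"
    then show "x \<otimes> y \<in> ramification_semigroup G r"
      by (simp add: ramification_semigroup_def generated_subsemigroup.mult)
  qed
qed

lemma GKdim_no_submonoid: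
  assumes "\<not> submonoid (ramification_semigroup G r) G"
  shows "GKdim (leavitt_path_algebra K \<Gamma>) = 0"
proof (rule antisym)
  show "GKdim (leavitt_path_algebra K \<Gamma>) \<le> 0"
  proof (rule GKdim_acyclic)
    fix x p assume walk: "awalk x p x"
    then obtain ts where ts: "set ts \<subseteq> labels" "p = lpath x ts" "x = x \<otimes> lprod ts"
      using awalk_imp_lpath by blast
    have "x \<in> carrier G" using awalk_hd_in_verts[OF walk] by simp
    then have "lprod ts = \<one>" using ts r_cancel_one'[of "lprod ts" x] l_cancel_one'[of x "lprod ts"] by simp
    then have "ts = []" using ts(1) assms by (auto simp: submonoid_iff)
    then show "p = []" using ts(2) by simp
  qed
  show "0 \<le> GKdim (leavitt_path_algebra K \<Gamma>)"
    unfolding leavitt_path_algebra_eq by (rule P.GKdim_nonneg)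
qed

text \<open>All edges carry the same label \<open>(c, i)\<close>; cancelling \<open>c\<close> on the
  right shows that no two of them have the same head.\<close>

lemma GKdim_single_label:
  assumes "labels = {t}"
  shows "GKdim (leavitt_path_algebra K \<Gamma>) \<le> 1"
proof (rule GKdim_functional_graph)
  obtain c i where t: "t = (c, i)" by (cases t)
  have arcs: "e \<in> arcs \<Gamma> \<longleftrightarrow> (\<exists>x\<in>carrier G. e = (x, c, i))" for e
    by (cases e) (auto simp: assms t)
  show "out_arcs \<Gamma> (tail \<Gamma> e) = {e}" if "e \<in> arcs \<Gamma>" for e
    using that by (auto simp: arcs out_arcs_def)
  have "c \<in> carrier G" using labels_closed[of c i] by (simp add: assms t)
  then show "inj_on (head \<Gamma>) (arcs \<Gamma>)"
    by (intro inj_onI) (auto simp: arcs)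
qed

subsection \<open>Linear independence of paths\<close>

text \<open>A state is an infinite path, given by its first vertex and its labels, together with an
  integer. A function on states is pulled back along \<^term>\<open>step a\<close>, so an edge, which
  here removes the first edge of a path, acts on indicator functions by prepending itself. The
  integer records the degree, without which a cycle with no exit would act as the identity.\<close>
fun step :: "('g, 'g \<times> 'g \<times> nat) leavitt_gen \<Rightarrow> 'g \<times> (nat \<Rightarrow> 'g \<times> nat) \<times> int \<Rightarrow>
    ('g \<times> (nat \<Rightarrow> 'g \<times> nat) \<times> int) option" where
  "step a (x, f, n) = (if x \<in> carrier G \<and> range f \<subseteq> labels then
     (case a of
        Vertex v \<Rightarrow> if x = v then Some (x, f, n) else None
      | Edge (y, t) \<Rightarrow> if x = y \<and> f 0 = t then Some (x \<otimes> fst t, f \<circ> Suc, n - 1) else None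
      | Ghost (y, t) \<Rightarrow> if y \<in> carrier G \<and> t \<in> labels \<and> x = y \<otimes> fst t
          then Some (y, case_nat t f, n + 1) else None)
     else None)"

lemma step_valid:
  assumes "x \<in> carrier G" "range f \<subseteq> labels"
  shows "step (Vertex v) (x, f, n) = (if x = v then Some (x, f, n) else None)"
    "step (Edge (y, c, i)) (x, f, n) =
      (if x = y \<and> f 0 = (c, i) then Some (x \<otimes> c, f \<circ> Suc, n - 1) else None)"
    "step (Ghost (y, c, i)) (x, f, n) = (if y \<in> carrier G \<and> (c, i) \<in> labels \<and> x = y \<otimes> c
      then Some (y, case_nat (c, i) f, n + 1) else None)"
  using assms by simp_all

lemma case_nat_comp_Suc [simp]: "case_nat t f \<circ> Suc = f"
  by (simp add: fun_eq_iff)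

lemma case_nat_shift [simp]: "f 0 = t \<Longrightarrow> case_nat t (f \<circ> Suc) = f"
  by (auto simp: fun_eq_iff split: nat.split)

lemma range_case_nat: "range (case_nat t f) = insert t (range f)"
  by (auto simp: image_iff split: nat.splits)

declare step.simps [simp del]

lemma step_relations:
  assumes "f \<in> rels"
  shows "act step f h b = 0"
proof -
  obtain x g n where b: "b = (x, g, n)" by (cases b)
  show ?thesis
  proof (cases "x \<in> carrier G \<and> range g \<subseteq> labels")
    case False
    \<comment> \<open>No letter is defined on an invalid state, so every nonempty word acts there as
      zero, and the relations contain no empty word.\<close>
    then have "pull step (a # u) b = None" for a u by (auto simp: b step.simps)
    then have none: "pull_back step (a # u) h b = 0" for a u
      unfolding pull_back_def by (simp del: pull.simps)
    show ?thesis
      using assms unfolding leavitt_relations_def Let_def free_gen_def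
      by (auto simp: word_mult act_diff act_single act_sum none simp del: hopf_graph_simps)
  next
    case True
    then have x: "x \<in> carrier G" and g: "range g \<subseteq> labels" by auto
    have gS: "range (g \<circ> Suc) \<subseteq> labels" "g 0 \<in> labels" using g by auto
    note eval = b x g word_mult act_diff act_single pull_back_def step_valid
    \<comment> \<open>Only the first edge of the path in the state contributes: it is removed and
      put back, which also restores the degree. This is where paths have to be infinite, since an
      empty path would have no first edge and violate relation (iv).\<close>
    have ck2: "(\<Sum>e\<in>out_arcs \<Gamma> v. pull_back step [Edge e, Ghost e] h b) = pull_back step [Vertex v] h b"
      if v: "v \<in> carrier G" "finite (out_arcs \<Gamma> v)" for v
    proof -
      have "pull_back step [Edge e, Ghost e] h b = (if e = (x, g 0) then h b else 0)"
        if "e \<in> out_arcs \<Gamma> v" for e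
        using that gS labels_closed by (cases e) (auto simp: eval out_arcs_def)
      then have "(\<Sum>e\<in>out_arcs \<Gamma> v. pull_back step [Edge e, Ghost e] h b) =
          (\<Sum>e\<in>out_arcs \<Gamma> v. if e = (x, g 0) then h b else 0)"
        by (intro sum.cong) auto
      also have "\<dots> = (if x = v then h b else 0)"
        using v x gS(2) by (cases "g 0") (auto simp: out_arcs_def)
      also have "\<dots> = pull_back step [Vertex v] h b" by (simp add: eval)
      finally show ?thesis .
    qed
    show ?thesis
      using assms unfolding leavitt_relations_def Let_def free_gen_def
    proof (elim UnE CollectE exE conjE)
      fix v assume "f = word [Vertex v] - (\<Sum>e\<in>out_arcs \<Gamma> v. word [Edge e] * word [Ghost e])"
        "v \<in> verts \<Gamma>" "finite (out_arcs \<Gamma> v)"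
      then show ?thesis
        using ck2 by (simp add: word_mult act_diff act_sum act_single)
    next
      fix v w assume "f = word [Vertex v] * word [Vertex w] - (if v = w then word [Vertex w] else 0)"
        "v \<in> verts \<Gamma>"
      then show ?thesis by (auto simp: eval)
    next
      fix e assume "f = word [Vertex (tail \<Gamma> e)] * word [Edge e] - word [Edge e]"
        "e \<in> arcs \<Gamma>"
      then show ?thesis by (cases e) (simp add: eval)
    next
      fix e assume "f = word [Edge e] * word [Vertex (head \<Gamma> e)] - word [Edge e]" "e \<in> arcs \<Gamma>"
      moreover obtain y c i where "e = (y, c, i)" by (cases e)
      ultimately show ?thesis using labels_closed[of c i] g
        by (auto simp add: eval image_subset_iff)
    next
      fix e assume "f = word [Vertex (head \<Gamma> e)] * word [Ghost e] - word [Ghost e]" "e \<in> arcs \<Gamma>"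
      moreover obtain y c i where "e = (y, c, i)" by (cases e)
      ultimately show ?thesis using labels_closed[of c i] by (auto simp add: eval)
    next
      fix e assume "f = word [Ghost e] * word [Vertex (tail \<Gamma> e)] - word [Ghost e]" "e \<in> arcs \<Gamma>"
      moreover obtain y c i where "e = (y, c, i)" by (cases e)
      ultimately show ?thesis using g by (auto simp add: eval range_case_nat)
    next
      fix e e' assume "f = word [Ghost e] * word [Edge e'] - (if e = e' then word [Vertex (head \<Gamma> e)] else 0)"
        "e \<in> arcs \<Gamma>" "e' \<in> arcs \<Gamma>"
      moreover obtain y c i where "e = (y, c, i)" by (cases e)
      moreover obtain y' c' i' where "e' = (y', c', i')" by (cases e')
      ultimately show ?thesis using g by (auto simp add: eval range_case_nat)
    qed
  qed
qed

lemma pull_lpath: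
  "x \<in> carrier G \<Longrightarrow> range g \<subseteq> labels \<Longrightarrow> (\<And>k. k < length ts \<Longrightarrow> g k = ts ! k) \<Longrightarrow>
    pull step (map Edge (lpath x ts)) (x, g, n) =
      Some (x \<otimes> lprod ts, \<lambda>k. g (k + length ts), n - int (length ts))"
proof (induction ts arbitrary: x g n)
  case (Cons t ts)
  obtain c i where t: "t = (c, i)" by (cases t)
  have g0: "g 0 = (c, i)" using Cons.prems(3)[of 0] t by simp
  then have lab: "(c, i) \<in> labels" using Cons.prems(2) by (metis range_subsetD)
  then have c: "c \<in> carrier G" by (rule labels_closed)
  have ts: "set ts \<subseteq> labels"
  proof
    fix u assume "u \<in> set ts"
    then obtain k where "k < length ts" "u = ts ! k" by (auto simp: in_set_conv_nth)
    then have "u = g (Suc k)" using Cons.prems(3)[of "Suc k"] by simp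
    then show "u \<in> labels" using Cons.prems(2) by auto
  qed
  have "pull step (map Edge (lpath (x \<otimes> c) ts)) (x \<otimes> c, g \<circ> Suc, n - 1) =
      Some (x \<otimes> c \<otimes> lprod ts, \<lambda>k. (g \<circ> Suc) (k + length ts), n - 1 - int (length ts))"
    using Cons.prems c by (intro Cons.IH) auto
  then show ?case using Cons.prems(1,2) c ts g0 by (simp add: t m_assoc step_valid)
qed simp

text \<open>The change of degree reveals the length of the word and the initial state reveals its
  letters, so a pair of states identifies a label word.\<close>

lemma pull_lpath_Some:
  "pull step (map Edge (lpath y ts)) (x, g, n) = Some (z, g', m) \<Longrightarrow>
    m = n - int (length ts) \<and> (\<forall>k < length ts. g k = ts ! k)"
proof (induction ts arbitrary: x y g n)
  case (Cons t ts)
  obtain c i where t: "t = (c, i)" by (cases t)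
  have "g 0 = (c, i)" and "pull step (map Edge (lpath (y \<otimes> c) ts)) (x \<otimes> c, g \<circ> Suc, n - 1) = Some (z, g', m)"
    using Cons.prems by (auto simp: t step.simps split: if_splits)
  with Cons.IH[OF this(2)] show ?case by (auto simp: t nth_Cons split: nat.split)
qed simp

text \<open>All paths start at the vertex 1 and are coded by their label words, so counting words is
  enough. \<open>F\<close> is fixed before \<open>q\<close>, because all these paths must lie in one
  finitely generated subalgebra.\<close>

lemma GKdim_lower_paths:
  fixes m d :: nat
  assumes F: "finite F" "F \<subseteq> arcs \<Gamma>" and d: "d > 0"
    and W: "\<And>q. q > 0 \<Longrightarrow> \<exists>W. finite W \<and> q ^ m \<le> card W \<and>
      (\<forall>ts\<in>W. ts \<noteq> [] \<and> set ts \<subseteq> labels \<and> set (lpath \<one> ts) \<subseteq> F \<and> length ts \<le> d * q)"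
  shows "ereal (real m) \<le> GKdim (leavitt_path_algebra K \<Gamma>)"
  unfolding leavitt_path_algebra_eq
proof (rule P.GKdim_lower[OF _ _ d])
  let ?F = "(\<lambda>a. wcls [a]) ` Edge ` F"
  show "finite ?F" "?F \<subseteq> carrier P.L" using F by (auto intro!: P.cls_closed)
  fix q :: nat assume q: "q > 0"
  obtain W where W: "finite W" "q ^ m \<le> card W" "\<And>ts. ts \<in> W \<Longrightarrow> ts \<noteq> []"
    "\<And>ts. ts \<in> W \<Longrightarrow> set ts \<subseteq> labels" "\<And>ts. ts \<in> W \<Longrightarrow> set (lpath \<one> ts) \<subseteq> F"
    "\<And>ts. ts \<in> W \<Longrightarrow> length ts \<le> d * q"
    using W[OF q] by blast
  define path :: "_ \<Rightarrow> ('g, 'g \<times> 'g \<times> nat) leavitt_gen list" where "path ts = map Edge (lpath \<one> ts)" for ts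
  define U where "U = path ` W"
  have inj_path: "inj_on path W"
  proof (rule inj_onI)
    fix ts us assume "path ts = path us"
    then have "lpath \<one> ts = lpath \<one> us" unfolding path_def by (rule map_injective) (simp add: inj_def)
    then show "ts = us" using map_snd_lpath by metis
  qed
  have sep: "\<exists>b b'. \<forall>v\<in>U. pull step v b = Some b' \<longleftrightarrow> v = path ts" if ts: "ts \<in> W" for ts
  proof -
    have ne: "ts \<noteq> []" and lab: "set ts \<subseteq> labels" using W ts by auto
    \<comment> \<open>The path is continued to an infinite one by repeating a label that is known to
      exist; the continuation is irrelevant for the separation.\<close>
    define g where "g k = (if k < length ts then ts ! k else hd ts)" for k
    have g: "range g \<subseteq> labels" using ne lab by (auto simp: g_def)
    let ?b = "(\<one>, g, 0)" and ?b' = "(\<one> \<otimes> lprod ts, \<lambda>k. g (k + length ts), 0 - int (length ts))"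
    have "pull step (path us) ?b = Some ?b' \<longleftrightarrow> path us = path ts" if us: "us \<in> W" for us
    proof
      assume "pull step (path us) ?b = Some ?b'"
      then have "length us = length ts" "\<And>k. k < length us \<Longrightarrow> g k = us ! k"
        using pull_lpath_Some[of \<one> us] unfolding path_def by fastforce+
      then have "us = ts" by (intro nth_equalityI) (auto simp: g_def)
      then show "path us = path ts" by simp
    next
      assume "path us = path ts"
      then show "pull step (path us) ?b = Some ?b'"
        using pull_lpath[of \<one> g ts 0] g by (simp add: path_def g_def)
    qed
    then show ?thesis unfolding U_def by (intro exI[of _ ?b] exI[of _ ?b']) auto
  qed
  have U: "finite U" "[] \<notin> U" "\<And>u. u \<in> U \<Longrightarrow> set u \<subseteq> gens"
  proof -
    show "finite U" using W(1) by (simp add: U_def)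
    have "path ts \<noteq> []" if "ts \<in> W" for ts
      using W(3)[OF that] length_lpath[of \<one> ts] unfolding path_def by (metis Nil_is_map_conv length_0_conv)
    then show "[] \<notin> U" unfolding U_def by force
    show "set u \<subseteq> gens" if "u \<in> U" for u
      using that W(5) F(2) unfolding U_def path_def by fastforce
  qed
  have sepU: "\<exists>b b'. \<forall>v\<in>U. pull step v b = Some b' \<longleftrightarrow> v = u" if "u \<in> U" for u
    using that sep unfolding U_def by blast
  have indep: "lin_independent P.L (wcls ` U)" and inj: "inj_on wcls U"
    using P.lin_independent_words[of step U, OF step_relations U sepU] by blast+
  have "card (wcls ` U) = card W"
    using card_image[OF inj] card_image[OF inj_path] by (simp add: U_def)
  moreover have "wcls ` U \<subseteq> power_gens P.L ?F (d * q)"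
  proof
    fix z assume "z \<in> wcls ` U"
    then obtain ts where ts: "ts \<in> W" "z = wcls (path ts)" by (auto simp: U_def)
    have "path ts \<noteq> []" using U(2) ts(1) unfolding U_def by force
    moreover have "set (path ts) \<subseteq> Edge ` F" using W(5)[OF ts(1)] by (auto simp: path_def)
    moreover have "Edge ` F \<subseteq> gens" using F(2) by auto
    moreover have "length (path ts) \<le> d * q" using W(6)[OF ts(1)] by (simp add: path_def)
    ultimately show "z \<in> power_gens P.L ?F (d * q)"
      unfolding ts(2) by (rule P.cls_word_in_power_gens)
  qed
  ultimately show "\<exists>I\<subseteq>power_gens P.L ?F (d * q). lin_independent P.L I \<and> q ^ m \<le> card I"
    using indep W(2) by (intro exI[of _ "wcls ` U"]) auto
qed

subsection \<open>Families of paths\<close>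

text \<open>A word with product 1 returns to the vertex where it starts, so repeating it traverses
  no new edges.\<close>

lemma lpath_replicate:
  assumes "x \<in> carrier G" "set w \<subseteq> labels" "lprod w = \<one>" "set ts \<subseteq> labels"
  shows "lprod (concat (replicate k w) @ ts) = lprod ts"
    "set (lpath x (concat (replicate k w) @ ts)) \<subseteq> set (lpath x w) \<union> set (lpath x ts)"
  using assms
proof (induction k)
  case (Suc k)
  have "set (concat (replicate k w) @ ts) \<subseteq> labels" using assms by auto
  then show "lprod (concat (replicate (Suc k) w) @ ts) = lprod ts"
    "set (lpath x (concat (replicate (Suc k) w) @ ts)) \<subseteq> set (lpath x w) \<union> set (lpath x ts)"
    using Suc assms by (simp_all add: lprod_append lpath_append)
qed auto

lemma GKdim_ge_one:
  assumes "submonoid (ramification_semigroup G r) G"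
  shows "1 \<le> GKdim (leavitt_path_algebra K \<Gamma>)"
proof -
  obtain w where w: "w \<noteq> []" "set w \<subseteq> labels" "lprod w = \<one>"
    using assms by (auto simp: submonoid_iff)
  have "ereal (real 1) \<le> GKdim (leavitt_path_algebra K \<Gamma>)"
  proof (rule GKdim_lower_paths[of "set (lpath \<one> w)" "length w"])
    show "set (lpath \<one> w) \<subseteq> arcs \<Gamma>" using w by (intro lpath_arcs) auto
    fix q :: nat assume "q > 0"
    let ?f = "\<lambda>k. concat (replicate k w)"
    have len: "length (?f k) = k * length w" for k by (induction k) auto
    have inj: "inj_on ?f {1..q}"
      by (rule inj_onI) (metis len length_0_conv mult_cancel2 w(1))
    show "\<exists>W. finite W \<and> q ^ 1 \<le> card W \<and> (\<forall>ts\<in>W. ts \<noteq> [] \<and> set ts \<subseteq> labels \<and>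
        set (lpath \<one> ts) \<subseteq> set (lpath \<one> w) \<and> length ts \<le> length w * q)"
    proof (intro exI[of _ "?f ` {1..q}"] conjI ballI)
      show "q ^ 1 \<le> card (?f ` {1..q})" using card_image[OF inj] by simp
      fix ts assume "ts \<in> ?f ` {1..q}"
      then obtain k where k: "ts = ?f k" "1 \<le> k" "k \<le> q" by auto
      show "ts \<noteq> []" using k w(1) by auto
      show "set ts \<subseteq> labels" using k w(2) by auto
      show "set (lpath \<one> ts) \<subseteq> set (lpath \<one> w)"
        using lpath_replicate(2)[of \<one> w "[]" k] w k by simp
      show "length ts \<le> length w * q" using k len[of k] by (simp add: mult.commute)
    qed simp
  qed (use w in auto)
  then show ?thesis by (simp add: one_ereal_def)
qed

text \<open>Copies of \<open>w\<close> are peeled off both sides together. If only one side ran out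
  of them, its \<open>t\<close> would face the first letter of \<open>w\<close>, which differs from
  \<open>t\<close>.\<close>

lemma replicate_prefix_code:
  assumes "w \<noteq> []" "hd w \<noteq> t"
    and "concat (replicate k w) @ t # u = concat (replicate l w) @ t # v"
  shows "k = l \<and> u = v"
  using assms(3)
proof (induction k arbitrary: l)
  case 0
  then show ?case using assms(1,2) by (cases l; cases w) auto
next
  case (Suc k)
  then obtain l' where "l = Suc l'" using assms(1,2) by (cases l; cases w) auto
  then show ?case using Suc by auto
qed

definition loop_word :: "('g \<times> nat) list \<Rightarrow> 'g \<times> nat \<Rightarrow> nat list \<Rightarrow> ('g \<times> nat) list" where
  "loop_word w t ks = concat (map (\<lambda>k. concat (replicate k w) @ [t]) ks)"

lemma loop_word_simps [simp]:
  "loop_word w t [] = []"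
  "loop_word w t (k # ks) = concat (replicate k w) @ t # loop_word w t ks"
  by (simp_all add: loop_word_def)

lemma loop_word_inject:
  assumes "w \<noteq> []" "hd w \<noteq> t" "length ks = length ls" "loop_word w t ks = loop_word w t ls"
  shows "ks = ls"
  using assms(3,4)
  by (induction ks ls rule: list_induct2) (auto dest: replicate_prefix_code[OF assms(1,2)])

lemma loop_word_labels: "set w \<subseteq> labels \<Longrightarrow> t \<in> labels \<Longrightarrow> set (loop_word w t ks) \<subseteq> labels"
  by (induction ks) auto

text \<open>A block has at most \<open>q * length w + 1\<close> letters, and \<open>q > 0\<close>
  absorbs the final 1 into the factor \<open>q\<close>.\<close>

lemma length_loop_word:
  "q > 0 \<Longrightarrow> set ks \<subseteq> {..<q} \<Longrightarrow> length (loop_word w t ks) \<le> length ks * Suc (length w) * q"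
proof (induction ks)
  case (Cons k ks)
  have "length (concat (replicate k w)) = k * length w" by (induction k) auto
  also have "\<dots> \<le> q * length w" using Cons.prems by (intro mult_le_mono) auto
  finally show ?case using Cons by (simp add: algebra_simps)
qed simp

text \<open>Only the letter \<open>(c, i)\<close> moves the base point, from
  \<open>x \<otimes> c [^] j\<close> to the next power. The edges used therefore depend on the
  number of blocks but not on the exponents.\<close>

lemma lpath_loop_word:
  assumes "x \<in> carrier G" "set w \<subseteq> labels" "lprod w = \<one>" "(c, i) \<in> labels"
  shows "set (lpath x (loop_word w (c, i) ks)) \<subseteq>
    (\<Union>j<length ks. set (lpath (x \<otimes> c [^] j) (w @ [(c, i)])))"
  using assms(1)
proof (induction ks arbitrary: x)
  case (Cons k ks)
  have c: "c \<in> carrier G" using assms(4) by (rule labels_closed)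
  have lab: "set (loop_word w (c, i) ks) \<subseteq> labels" using assms by (intro loop_word_labels)
  have "set (lpath x (loop_word w (c, i) (k # ks))) \<subseteq>
      set (lpath x w) \<union> set (lpath x ((c, i) # loop_word w (c, i) ks))"
    unfolding loop_word_simps using Cons.prems assms lab by (intro lpath_replicate) auto
  also have "\<dots> = set (lpath x (w @ [(c, i)])) \<union> set (lpath (x \<otimes> c) (loop_word w (c, i) ks))"
    using Cons.prems assms by (simp add: lpath_append)
  also have "\<dots> \<subseteq> (\<Union>j<length (k # ks). set (lpath (x \<otimes> c [^] j) (w @ [(c, i)])))"
  proof -
    have "set (lpath (x \<otimes> c) (loop_word w (c, i) ks)) \<subseteq>
        (\<Union>j<length ks. set (lpath (x \<otimes> c \<otimes> c [^] j) (w @ [(c, i)])))"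
      using Cons.prems c by (intro Cons.IH) simp
    also have "\<dots> = (\<Union>j<length ks. set (lpath (x \<otimes> c [^] Suc j) (w @ [(c, i)])))"
      using Cons.prems c by (intro SUP_cong refl) (simp add: m_assoc nat_pow_Suc2[symmetric] del: nat_pow_Suc)
    also have "\<dots> \<subseteq> (\<Union>j<length (k # ks). set (lpath (x \<otimes> c [^] j) (w @ [(c, i)])))"
      by (intro UN_least) force
    finally have 1: "set (lpath (x \<otimes> c) (loop_word w (c, i) ks)) \<subseteq>
      (\<Union>j<length (k # ks). set (lpath (x \<otimes> c [^] j) (w @ [(c, i)])))" .
    have "set (lpath x (w @ [(c, i)])) = set (lpath (x \<otimes> c [^] (0::nat)) (w @ [(c, i)]))"
      using Cons.prems by simp
    then have 2: "set (lpath x (w @ [(c, i)])) \<subseteq>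
      (\<Union>j<length (k # ks). set (lpath (x \<otimes> c [^] j) (w @ [(c, i)])))"
      by (intro order_trans[OF _ UN_upper[of 0]]) auto
    show ?thesis using 1 2 by blast
  qed
  finally show ?case .
qed simp

text \<open>Each \<open>m\<close> has its own finite set of edges and hence its own subalgebra, in
  which polynomial growth of degree at least \<open>m\<close> is found; the supremum over all
  \<open>m\<close> is infinite.\<close>

lemma GKdim_infinite:
  assumes "submonoid (ramification_semigroup G r) G" and two: "t1 \<in> labels" "t2 \<in> labels" "t1 \<noteq> t2"
  shows "GKdim (leavitt_path_algebra K \<Gamma>) = \<infinity>"
proof -
  obtain w where w: "w \<noteq> []" "set w \<subseteq> labels" "lprod w = \<one>"
    using assms by (auto simp: submonoid_iff)
  \<comment> \<open>Two different labels cannot both be the first letter of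
    \<open>w\<close>.\<close>
  obtain t where "t \<in> labels" "hd w \<noteq> t" using two by metis
  then obtain c i where t: "(c, i) \<in> labels" "hd w \<noteq> (c, i)" by (cases t) auto
  have ge: "ereal (real m) \<le> GKdim (leavitt_path_algebra K \<Gamma>)" if m: "m > 0" for m
  proof (rule GKdim_lower_paths)
    let ?F = "\<Union>j<m. set (lpath (\<one> \<otimes> c [^] j) (w @ [(c, i)]))"
    show "finite ?F" by simp
    show "?F \<subseteq> arcs \<Gamma>" using w t labels_closed[OF t(1)] by (intro UN_least lpath_arcs) auto
    show "m * Suc (length w) > 0" using m by simp
    fix q :: nat assume q: "q > 0"
    let ?N = "{ks. set ks \<subseteq> {..<q} \<and> length ks = m}"
    show "\<exists>W. finite W \<and> q ^ m \<le> card W \<and> (\<forall>ts\<in>W. ts \<noteq> [] \<and> set ts \<subseteq> labels \<and>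
        set (lpath \<one> ts) \<subseteq> ?F \<and> length ts \<le> m * Suc (length w) * q)"
    proof (intro exI[of _ "loop_word w (c, i) ` ?N"] conjI ballI)
      show "finite (loop_word w (c, i) ` ?N)" by (simp add: finite_lists_length_eq)
      have "inj_on (loop_word w (c, i)) ?N"
        by (rule inj_onI) (use loop_word_inject[OF w(1) t(2)] in auto)
      then show "q ^ m \<le> card (loop_word w (c, i) ` ?N)"
        by (simp add: card_image card_lists_length_eq)
      fix ts assume "ts \<in> loop_word w (c, i) ` ?N"
      then obtain ks where ks: "ts = loop_word w (c, i) ks" "set ks \<subseteq> {..<q}" "length ks = m" by auto
      show "ts \<noteq> []" using ks m by (cases ks) auto
      show "set ts \<subseteq> labels" unfolding ks(1) by (rule loop_word_labels[OF w(2) t(1)])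
      show "set (lpath \<one> ts) \<subseteq> ?F"
        using lpath_loop_word[OF one_closed w(2,3) t(1), of ks] ks by simp
      show "length ts \<le> m * Suc (length w) * q" using length_loop_word[OF q ks(2)] ks by simp
    qed
  qed
  show ?thesis
  proof (rule ereal_top)
    fix B :: real
    obtain m where "B \<le> real m" using real_arch_simple by blast
    then have "ereal B \<le> ereal (real (Suc m))" by simp
    also have "\<dots> \<le> GKdim (leavitt_path_algebra K \<Gamma>)" by (rule ge) simp
    finally show "ereal B \<le> GKdim (leavitt_path_algebra K \<Gamma>)" .
  qed
qed

subsection \<open>The ramification degree\<close>

text \<open>Makes it injective to forget the class in a triple \<open>(C, i, c)\<close>, so that
  \<open>labels\<close> has the cardinality of the ramification degree.\<close>

lemma conj_class_unique:
  assumes "C \<in> conj_classes G" "D \<in> conj_classes G" "c \<in> C" "c \<in> D"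
  shows "C = D"
proof -
  let ?cl = "\<lambda>x. {g \<otimes> x \<otimes> inv g | g. g \<in> carrier G}"
  have sub: "?cl y \<subseteq> ?cl x" if x: "x \<in> carrier G" and g: "g \<in> carrier G" and y: "y = g \<otimes> x \<otimes> inv g" for x y g
  proof
    fix z assume "z \<in> ?cl y"
    then obtain h where h: "h \<in> carrier G" "z = h \<otimes> y \<otimes> inv h" by blast
    then have "z = (h \<otimes> g) \<otimes> x \<otimes> inv (h \<otimes> g)" using x g y by (simp add: inv_mult_group m_assoc)
    then show "z \<in> ?cl x" using h g by blast
  qed
  have eq: "?cl y = ?cl x" if x: "x \<in> carrier G" and "y \<in> ?cl x" for x y
  proof -
    obtain g where g: "g \<in> carrier G" "y = g \<otimes> x \<otimes> inv g" using \<open>y \<in> ?cl x\<close> by auto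
    then have "y \<otimes> g = g \<otimes> x" using x by (simp add: m_assoc)
    moreover have "inv g \<otimes> (g \<otimes> x) = x" using x g(1) by (simp flip: m_assoc)
    moreover have yc: "y \<in> carrier G" using x g by simp
    ultimately have "x = inv g \<otimes> y \<otimes> inv (inv g)" using g(1) by (simp add: m_assoc)
    then have "?cl x \<subseteq> ?cl y" using yc g(1) by (intro sub[of y "inv g" x]) simp_all
    with sub[OF x g] show ?thesis by (rule subset_antisym)
  qed
  from assms(1) obtain x where x: "C = ?cl x" "x \<in> carrier G"
    unfolding conj_classes_def by (rule imageE)
  from assms(2) obtain y where y: "D = ?cl y" "y \<in> carrier G"
    unfolding conj_classes_def by (rule imageE)
  show ?thesis
    using eq[OF x(2) assms(3)[unfolded x(1)]] eq[OF y(2) assms(4)[unfolded y(1)]]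
    unfolding x(1) y(1) by (rule trans[OF sym])
qed

lemma labels_eq_image:
  "labels = (\<lambda>(C, i, c). (c, i)) ` (SIGMA C : conj_classes G. {..<r C} \<times> C)"
proof (intro equalityI subsetI)
  fix t assume "t \<in> labels"
  then obtain c i C where "t = (c, i)" "C \<in> conj_classes G" "c \<in> C" "i < r C"
    by (auto simp: labels_def)
  then show "t \<in> (\<lambda>(C, i, c). (c, i)) ` (SIGMA C : conj_classes G. {..<r C} \<times> C)"
    by (intro image_eqI[of _ _ "(C, i, c)"]) auto
qed (auto simp: labels_def)

text \<open>The cardinal inequality amounts to an injection of \<open>bool\<close>, whose two values
  give the labels; infinite degrees are covered alike.\<close>

lemma ramification_degree_ge_two:
  assumes "ctwo \<le>o ramification_degree G r"
  obtains t1 t2 where "t1 \<in> labels" "t2 \<in> labels" "t1 \<noteq> t2"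
proof -
  let ?A = "SIGMA C : conj_classes G. {..<r C} \<times> C"
  have "|UNIV :: bool set| \<le>o |?A|" using assms by (simp add: ramification_degree_def ctwo_def)
  then obtain f :: "bool \<Rightarrow> _" where f: "inj f" "range f \<subseteq> ?A"
    by (auto simp flip: card_of_ordLeq)
  have inj: "inj_on (\<lambda>(C, i, c). (c, i)) ?A"
    by (rule inj_onI) (auto dest: conj_class_unique)
  have "f True \<noteq> f False" using f(1) by (auto dest: injD)
  then have "(\<lambda>(C, i, c). (c, i)) (f True) \<noteq> (\<lambda>(C, i, c). (c, i)) (f False)"
    using inj_onD[OF inj] f(2) by blast
  moreover have "(\<lambda>(C, i, c). (c, i)) (f b) \<in> labels" for b
    using f(2) unfolding labels_eq_image by blast
  ultimately show thesis using that by blast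
qed

lemma ramification_degree_one:
  assumes "ramification_degree G r =o cone"
  obtains t where "labels = {t}"
proof -
  let ?A = "SIGMA C : conj_classes G. {..<r C} \<times> C"
  have "|?A| =o |{()}|" using assms by (simp add: ramification_degree_def cone_def)
  then obtain f where "bij_betw f ?A {()}" by (auto simp flip: card_of_ordIso)
  then have "card ?A = 1" by (simp add: bij_betw_same_card)
  then obtain a where "?A = {a}" by (rule card_1_singletonE)
  then show thesis using that unfolding labels_eq_image by simp
qed

lemma ramification_degree_cases:
  assumes "labels \<noteq> {}"
  shows "ctwo \<le>o ramification_degree G r \<or> ramification_degree G r =o cone"
proof -
  let ?A = "SIGMA C : conj_classes G. {..<r C} \<times> C"
  obtain a where a: "a \<in> ?A" using assms unfolding labels_eq_image by blast
  show ?thesis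
  proof (cases "?A = {a}")
    case True
    have "|{a}| =o |{()}|" by (rule card_of_ordIso[THEN iffD1]) (auto simp: bij_betw_def)
    then show ?thesis unfolding ramification_degree_def True cone_def by blast
  next
    case False
    then obtain b where b: "b \<in> ?A" "b \<noteq> a" using a by blast
    have "|UNIV :: bool set| \<le>o |?A|"
      using a b by (intro card_of_ordLeq[THEN iffD1] exI[of _ "\<lambda>x. if x then a else b"])
        (auto simp: inj_on_def)
    then show ?thesis unfolding ramification_degree_def ctwo_def by blast
  qed
qed

end

theorem theorem3p2:
  fixes G :: "('g, 'm) monoid_scheme" and r :: "'g set \<Rightarrow> nat"
  assumes "group G"
  shows "GKdim (leavitt_path_algebra TYPE('k::field) (hopf_graph G r)) =
    (if ctwo \<le>o ramification_degree G r \<and> submonoid (ramification_semigroup G r) G then \<infinity>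
     else if ramification_degree G r =o cone \<and> submonoid (ramification_semigroup G r) G then 1
     else 0)"
proof -
  interpret group G by (rule assms)
  interpret hopf G r "TYPE('k)" by unfold_locales
  show ?thesis
  proof (cases "submonoid (ramification_semigroup G r) G")
    case False
    then show ?thesis using GKdim_no_submonoid by simp
  next
    case True
    \<comment> \<open>A nonempty word with product 1 needs a letter, so degree 0 cannot occur
      together with the submonoid condition.\<close>
    then have "labels \<noteq> {}" by (auto simp: submonoid_iff)
    show ?thesis
    proof (cases "ctwo \<le>o ramification_degree G r")
      case two: True
      obtain t1 t2 where "t1 \<in> labels" "t2 \<in> labels" "t1 \<noteq> t2"
        using ramification_degree_ge_two[OF two] .
      then show ?thesis using GKdim_infinite[OF True] two True by simp
    next
      case False
      then have one: "ramification_degree G r =o cone"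
        using ramification_degree_cases[OF \<open>labels \<noteq> {}\<close>] by blast
      obtain t where "labels = {t}" using ramification_degree_one[OF one] .
      then show ?thesis
        using GKdim_single_label GKdim_ge_one[OF True] False one True by (simp add: antisym)
    qed
  qed
qed

end
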